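(* For $M\in\mathrm{HP}$ let $t_M\in\mathrm{PT}$ be the unique permutation tree with $t_M^+=\mathrm{BT}(M)$. For any $M,N\in\mathrm{HP}$ the following are equivalent: (1) $\mathcal H^+\vdash M=N$; (2) $t_M\,\sigma'_{\mathrm{PT}}\,t_N$; (3) $t_M^{\mathfrak m'}=t_N^{\mathfrak m'}$.
   Context: A tree is a nonempty prefix-closed finitely branching set $A\subseteq(\mathbb N^+)^*$ with $wj\in A$, $i<j$ implying $wi\in A$. A permutation tree is a map $t:A\to\mathrm{Sym}(\mathbb N^+)$ (possibly infinite) such that a node with exactly $n$ children has label in $S_n$ (permutations of $\mathbb N^+$ fixing all $i>n$). Write $t=\langle\pi;t_1,\dots,t_n\rangle$; $\bar\epsilon$ is the one-node tree, $\iota$ the identity; $\mathrm{PT}$ is the set of permutation trees. $E'$ is the set of finite permutation trees all of whose labels are $\iota$. $\le'$ is the greatest relation on $\mathrm{PT}$ such that $t\le'u$ with $t=\langle\pi;t_1..t_n\rangle$, $u=\langle\rho;u_1..u_m\rangle$ implies $\pi=\rho$, $m\le n$, $t_i\le'u_i$ for $1\le i\le m$ and $t_i\in E'$ for $m<i\le n$. $t\,\sigma'_{\mathrm{PT}}\,u$ iff there is $w\in\mathrm{PT}$ with $w\le't$ and $w\le'u$. $t^{\mathfrak m'}$ is defined coinductively: $\bar\epsilon^{\mathfrak m'}=\bar\epsilon$; for $t=\langle\pi;t_1..t_n\rangle$, $t^{\mathfrak m'}=(\langle\pi;t_1..t_{n-1}\rangle)^{\mathfrak m'}$ if $t_n\in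 E'$ and $\pi n=n$, otherwise $\langle\pi;t_1^{\mathfrak m'},..,t_n^{\mathfrak m'}\rangle$. Lambda side: $\mathcal H^+\vdash M=N$ iff for every context $C[\,]$, $C[M]$ has a $\beta$-normal form iff $C[N]$ has one. $\mathscr{HP}(x)$ is the largest set of Böhm-like trees with each $T$ of the form $\lambda x_1..x_n.x\,T_1\cdots T_n$, $\pi\in S_n$, $T_i\in\mathscr{HP}(x_{\pi i})$; $\mathscr{HP}=\{\lambda x.T\}$, $\mathrm{HP}=\{M:\mathrm{BT}(M)\in\mathscr{HP}\}$. The bijection $\mathrm{PT}\to\mathscr{HP}$, $t\mapsto t^+$, is defined coinductively by $\bar\epsilon^+=\lambda x.x$ and $\langle\pi;t_1..t_n\rangle^+=\lambda xx_1..x_n.x((t_1)^+x_{\pi1})\cdots((t_n)^+x_{\pi n})$, application of Böhm-like trees being computed by $\beta$-reduction as for $\lambda$-terms. *)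

theory Defs
  imports "HOL-Combinatorics.Permutations" "HOL-Library.BNF_Corec"
begin

section \<open>Lambda terms and the observational theory of normal forms\<close>

text \<open>Terms modulo alpha, in de Bruijn notation; free variables are dangling indices.\<close>

datatype tm = Var nat | App tm tm | Lam tm

text \<open>\<^term>\<open>lift_ren n f\<close> transports a renaming \<^term>\<open>f\<close> of variables under \<^term>\<open>n\<close> binders.\<close>

definition lift_ren :: "nat \<Rightarrow> (nat \<Rightarrow> nat) \<Rightarrow> nat \<Rightarrow> nat" where
  "lift_ren n f i = (if i < n then i else f (i - n) + n)"

primrec rename :: "(nat \<Rightarrow> nat) \<Rightarrow> tm \<Rightarrow> tm" where
  "rename f (Var i) = Var (f i)"
| "rename f (App s t) = App (rename f s) (rename f t)"
| "rename f (Lam s) = Lam (rename (lift_ren 1 f) s)"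

text \<open>Simultaneous capture-avoiding substitution.\<close>

primrec subst :: "(nat \<Rightarrow> tm) \<Rightarrow> tm \<Rightarrow> tm" where
  "subst \<theta> (Var i) = \<theta> i"
| "subst \<theta> (App s t) = App (subst \<theta> s) (subst \<theta> t)"
| "subst \<theta> (Lam s) = Lam (subst (case_nat (Var 0) (\<lambda>i. rename Suc (\<theta> i))) s)"

abbreviation subst0 :: "tm \<Rightarrow> tm \<Rightarrow> tm" where
  "subst0 s t \<equiv> subst (case_nat t Var) s"

inductive beta :: "tm \<Rightarrow> tm \<Rightarrow> bool" where
  "beta (App (Lam s) t) (subst0 s t)"
| "beta s s' \<Longrightarrow> beta (App s t) (App s' t)"
| "beta t t' \<Longrightarrow> beta (App s t) (App s t')"
| "beta s s' \<Longrightarrow> beta (Lam s) (Lam s')"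

definition beta_normal :: "tm \<Rightarrow> bool" where
  "beta_normal M \<longleftrightarrow> (\<nexists>N. beta M N)"

definition has_beta_nf :: "tm \<Rightarrow> bool" where
  "has_beta_nf M \<longleftrightarrow> (\<exists>N. beta\<^sup>*\<^sup>* M N \<and> beta_normal N)"

text \<open>Contexts have any number of holes, and filling a hole may capture free variables:
  hence there is no lifting in \<^term>\<open>fill\<close>.\<close>

datatype ctx = Hole | CVar nat | CApp ctx ctx | CLam ctx

primrec fill :: "ctx \<Rightarrow> tm \<Rightarrow> tm" where
  "fill Hole M = M"
| "fill (CVar i) M = Var i"
| "fill (CApp C D) M = App (fill C M) (fill D M)"
| "fill (CLam C) M = Lam (fill C M)"

definition Hplus :: "tm \<Rightarrow> tm \<Rightarrow> bool" where
  "Hplus M N \<longleftrightarrow> (\<forall>C. has_beta_nf (fill C M) \<longleftrightarrow> has_beta_nf (fill C N))"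


section \<open>Boehm-like trees\<close>

text \<open>\<^term>\<open>Hnf n y Ts\<close> stands for \<open>\<lambda>x\<^sub>1 \<dots> x\<^sub>n. y T\<^sub>1 \<dots> T\<^sub>m\<close>. Head and arguments live
  under the \<^term>\<open>n\<close> binders, so \<open>x\<^sub>j\<close> is the index \<^term>\<open>n - j\<close> (for \<open>1 \<le> j \<le> n\<close>),
  and a variable that is free in the whole tree with index \<^term>\<open>k\<close> appears as \<^term>\<open>k + n\<close>.\<close>

codatatype bt = Bot | Hnf (lams: nat) (hd_var: nat) (args: "bt list")

inductive weak_head :: "tm \<Rightarrow> tm \<Rightarrow> bool" where
  "weak_head (App (Lam s) t) (subst0 s t)"
| "weak_head s s' \<Longrightarrow> weak_head (App s t) (App s' t)"

inductive head_red :: "tm \<Rightarrow> tm \<Rightarrow> bool" where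
  "weak_head s s' \<Longrightarrow> head_red s s'"
| "head_red s s' \<Longrightarrow> head_red (Lam s) (Lam s')"

definition hnf :: "nat \<Rightarrow> nat \<Rightarrow> tm list \<Rightarrow> tm" where
  "hnf n y Ms = (Lam ^^ n) (foldl App (Var y) Ms)"

text \<open>The principal head normal form, if there is one. It is unique because head reduction
  is deterministic and \<^term>\<open>hnf\<close> is injective and yields head normal terms.\<close>

definition phnf :: "tm \<Rightarrow> (nat \<times> nat \<times> tm list) option" where
  "phnf M = (if \<exists>n y Ms. head_red\<^sup>*\<^sup>* M (hnf n y Ms)
     then Some (THE (n, y, Ms). head_red\<^sup>*\<^sup>* M (hnf n y Ms)) else None)"

primcorec BT :: "tm \<Rightarrow> bt" where
  "BT M = (case phnf M of None \<Rightarrow> Bot | Some (n, y, Ms) \<Rightarrow> Hnf n y (map BT Ms))"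

fun bt_Lam :: "bt \<Rightarrow> bt" where
  "bt_Lam Bot = Bot"
| "bt_Lam (Hnf n y Ts) = Hnf (Suc n) y Ts"

primcorec bt_rename :: "(nat \<Rightarrow> nat) \<Rightarrow> bt \<Rightarrow> bt" where
  "bt_rename f T = (case T of Bot \<Rightarrow> Bot
     | Hnf n y Ts \<Rightarrow> Hnf n (lift_ren n f y) (map (bt_rename (lift_ren n f)) Ts))"

text \<open>\<^term>\<open>bt_app T y\<close> is the beta-normal form of the application of the tree \<^term>\<open>T\<close>
  to the variable \<^term>\<open>y\<close>; contracting the redex \<open>(\<lambda>x. T) y\<close> is merely a renaming.\<close>

fun bt_app :: "bt \<Rightarrow> nat \<Rightarrow> bt" where
  "bt_app Bot y = Bot"
| "bt_app (Hnf 0 z Ts) y = Hnf 0 z (Ts @ [Hnf 0 y []])"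
| "bt_app (Hnf (Suc n) z Ts) y = bt_rename (case_nat y id) (Hnf n z Ts)"


section \<open>Hereditary permutations\<close>

text \<open>\<^term>\<open>HPT_var x\<close> is the set of trees written \<open>\<H>\<P>(x)\<close>.\<close>

coinductive HPT_var :: "nat \<Rightarrow> bt \<Rightarrow> bool" where
  "\<pi> permutes {1..n} \<Longrightarrow> length Ts = n \<Longrightarrow>
   (\<forall>i\<in>{1..n}. HPT_var (n - \<pi> i) (Ts ! (i - 1))) \<Longrightarrow> HPT_var x (Hnf n (x + n) Ts)"

definition HPT :: "bt set" where
  "HPT = {bt_Lam T | T. HPT_var 0 T}"

definition HP :: "tm set" where
  "HP = {M. BT M \<in> HPT}"


section \<open>Permutation trees\<close>

text \<open>A tree is represented by its root and the list of its immediate subtrees rather than as a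
  set of words; that set is recovered as \<^term>\<open>{w. node t w}\<close>. The set of positive naturals
  is embedded in \<^typ>\<open>nat\<close>: the labels of permutation trees fix \<^term>\<open>0\<close>.\<close>

codatatype (labels: 'a) tree = Node (label: 'a) (children: "'a tree list")

primrec node :: "'a tree \<Rightarrow> nat list \<Rightarrow> bool" where
  "node t [] \<longleftrightarrow> True"
| "node t (i # w) \<longleftrightarrow> i \<in> {1..length (children t)} \<and> node (children t ! (i - 1)) w"

type_synonym ptree = "(nat \<Rightarrow> nat) tree"

coinductive_set PT :: "ptree set" where
  "\<pi> permutes {1..length ts} \<Longrightarrow> (\<forall>t\<in>set ts. t \<in> PT) \<Longrightarrow> Node \<pi> ts \<in> PT"

definition E' :: "ptree set" where
  "E' = {t \<in> PT. finite {w. node t w} \<and> labels t \<subseteq> {id}}"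

coinductive le_PT :: "ptree \<Rightarrow> ptree \<Rightarrow> bool" where
  "Node \<pi> ts \<in> PT \<Longrightarrow> Node \<rho> us \<in> PT \<Longrightarrow> \<pi> = \<rho> \<Longrightarrow> length us \<le> length ts \<Longrightarrow>
   (\<forall>i<length us. le_PT (ts ! i) (us ! i)) \<Longrightarrow>
   (\<forall>i\<in>{length us..<length ts}. ts ! i \<in> E') \<Longrightarrow> le_PT (Node \<pi> ts) (Node \<rho> us)"

definition sigma_PT :: "ptree \<Rightarrow> ptree \<Rightarrow> bool" where
  "sigma_PT t u \<longleftrightarrow> (\<exists>w\<in>PT. le_PT w t \<and> le_PT w u)"

corecursive minimize :: "ptree \<Rightarrow> ptree" where
  "minimize t = (let \<pi> = label t; ts = children t; n = length ts in
     if ts \<noteq> [] \<and> last ts \<in> E' \<and> \<pi> n = n then minimize (Node \<pi> (butlast ts))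
     else Node \<pi> (map minimize ts))"
  by (relation "measure (length \<circ> children)") auto


section \<open>From permutation trees to Boehm-like trees\<close>

text \<open>\<^term>\<open>ptree_at x t\<close> is the result of applying the tree \<open>t\<^sup>+\<close> to the variable \<^term>\<open>x\<close>,
  see \<open>bt_app_ptree_bt\<close>. That \<^term>\<open>ptree_bt\<close> is the map \<open>t \<mapsto> t\<^sup>+\<close> is
  \<open>ptree_bt_eq\<close> (the trees \<open>t\<^sub>i\<^sup>+\<close> are closed, hence not lifted under the binders).\<close>

primcorec ptree_at :: "nat \<Rightarrow> ptree \<Rightarrow> bt" where
  "ptree_at x t = Hnf (length (children t)) (x + length (children t))
     (map (\<lambda>i. ptree_at (length (children t) - label t i) (children t ! (i - 1)))
       [1..<Suc (length (children t))])"

definition ptree_bt :: "ptree \<Rightarrow> bt" where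
  "ptree_bt t = bt_Lam (ptree_at 0 t)"

lemma PT_D:
  assumes "t \<in> PT"
  shows "label t permutes {1..length (children t)}"
    and "\<And>i. i < length (children t) \<Longrightarrow> children t ! i \<in> PT"
  using assms by (auto elim: PT.cases)

lemma permutes_le: "\<pi> permutes {1..n} \<Longrightarrow> i \<in> {1..n} \<Longrightarrow> 1 \<le> \<pi> i \<and> \<pi> i \<le> n" for n :: nat
  using permutes_in_image[of \<pi> "{1..n}" i] by auto

lemma bt_rename_ptree_at:
  assumes "t \<in> PT"
  shows "bt_rename f (ptree_at x t) = ptree_at (f x) t"
  using assms
proof (coinduction arbitrary: f x t)
  case (Eq_bt f x t)
  let ?n = "length (children t)"
  have "list_all2 (\<lambda>a b. \<exists>f x t. a = bt_rename f (ptree_at x t) \<and> b = ptree_at (f x) t \<and> t \<in> PT)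
     (args (bt_rename f (ptree_at x t))) (args (ptree_at (f x) t))"
  proof (rule list_all2_all_nthI)
    fix i assume "i < length (args (bt_rename f (ptree_at x t)))"
    then have i: "i < ?n"
      by (simp add: bt_rename.code[of f] ptree_at.code[of _ t] split: if_splits)
    have le: "label t (Suc i) \<ge> 1" "label t (Suc i) \<le> ?n"
      using permutes_le[OF PT_D(1)[OF Eq_bt], of "Suc i"] i by auto
    then have lt: "?n - label t (Suc i) < ?n" using i by auto
    have "args (bt_rename f (ptree_at x t)) ! i
        = bt_rename (lift_ren ?n f) (ptree_at (?n - label t (Suc i)) (children t ! i))"
      using i by (simp add: bt_rename.code[of f] ptree_at.code[of _ t] del: upt_Suc)
    moreover have "args (ptree_at (f x) t) ! i
        = ptree_at (lift_ren ?n f (?n - label t (Suc i))) (children t ! i)"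
      using i lt by (simp add: lift_ren_def ptree_at.code[of _ t] del: upt_Suc)
    ultimately show "\<exists>f' x' t'. args (bt_rename f (ptree_at x t)) ! i = bt_rename f' (ptree_at x' t')
        \<and> args (ptree_at (f x) t) ! i = ptree_at (f' x') t' \<and> t' \<in> PT"
      using PT_D(2)[OF Eq_bt i] by blast
  qed (simp add: bt_rename.code[of f] ptree_at.code[of _ t])
  moreover have "lams (bt_rename f (ptree_at x t)) = lams (ptree_at (f x) t)"
    "hd_var (bt_rename f (ptree_at x t)) = hd_var (ptree_at (f x) t)"
    "bt_rename f (ptree_at x t) \<noteq> Bot" "ptree_at (f x) t \<noteq> Bot"
    by (simp_all add: bt_rename.code[of f] ptree_at.code[of _ t] lift_ren_def)
  ultimately show ?case by blast
qed

lemma bt_app_ptree_bt: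
  assumes "t \<in> PT"
  shows "bt_app (ptree_bt t) y = ptree_at y t"
proof -
  obtain n z Ts where T: "ptree_at 0 t = Hnf n z Ts" by (metis ptree_at.code)
  have "bt_app (ptree_bt t) y = bt_rename (case_nat y id) (ptree_at 0 t)"
    by (simp add: ptree_bt_def T)
  then show ?thesis using bt_rename_ptree_at[OF assms] by simp
qed

lemma ptree_bt_eq:
  fixes n :: nat
  assumes "Node \<pi> ts \<in> PT" and n: "n = length ts"
  shows "ptree_bt (Node \<pi> ts)
    = Hnf (Suc n) n (map (\<lambda>i. bt_app (ptree_bt (ts ! (i - 1))) (n - \<pi> i)) [1..<Suc n])"
proof -
  have "bt_app (ptree_bt (ts ! (i - 1))) (n - \<pi> i) = ptree_at (n - \<pi> i) (ts ! (i - 1))"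
    if "i \<in> {1..n}" for i
    by (rule bt_app_ptree_bt) (use that PT_D(2)[OF assms(1), of "i - 1"] n in auto)
  then show ?thesis
    by (auto simp: ptree_bt_def ptree_at.code[of 0] n simp del: upt_Suc)
qed

lemma HPT_var_ptree_at: "t \<in> PT \<Longrightarrow> HPT_var x (ptree_at x t)"
proof (coinduction arbitrary: x t rule: HPT_var.coinduct)
  case (HPT_var x t)
  define n where "n = length (children t)"
  define Ts where "Ts = args (ptree_at x t)"
  have Ts: "length Ts = n" "Ts ! (i - 1) = ptree_at (n - label t i) (children t ! (i - 1))"
    if "i \<in> {1..n}" for i
    using that by (auto simp: Ts_def n_def simp del: upt_Suc)
  have "\<exists>t'. Ts ! (i - 1) = ptree_at (n - label t i) t' \<and> t' \<in> PT" if "i \<in> {1..n}" for i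
    using Ts(2)[OF that] PT_D(2)[OF HPT_var, of "i - 1"] that n_def by auto
  moreover have "label t permutes {1..n}" "length Ts = n" "ptree_at x t = Hnf n (x + n) Ts"
    using PT_D(1)[OF HPT_var] by (auto simp: n_def Ts_def ptree_at.code[of x] simp del: upt_Suc)
  ultimately show ?case by blast
qed

lemma ptree_at_inj:
  assumes "t \<in> PT" "u \<in> PT" "ptree_at x t = ptree_at y u"
  shows "t = u"
  using assms
proof (coinduction arbitrary: t u x y rule: tree.coinduct_strong)
  case (Eq_tree t u x y)
  let ?n = "length (children t)"
  have n: "length (children u) = ?n"
    using arg_cong[OF Eq_tree(3), of lams] by simp
  have perm: "label t permutes {1..?n}" "label u permutes {1..?n}"
    using PT_D(1)[OF Eq_tree(1)] PT_D(1)[OF Eq_tree(2)] n by auto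
  have ch: "ptree_at (?n - label t (Suc i)) (children t ! i)
      = ptree_at (?n - label u (Suc i)) (children u ! i)" if "i < ?n" for i
    using arg_cong[OF Eq_tree(3), of "\<lambda>T. args T ! i"] that n by (simp del: upt_Suc)
  have "label t i = label u i" for i
  proof (cases "i \<in> {1..?n}")
    case True
    have hd: "hd_var (ptree_at x t) - lams (ptree_at x t) = x" for x and t :: ptree by simp
    have "?n - label t i = ?n - label u i"
      using True hd[of _ "children t ! (i - 1)"] hd[of _ "children u ! (i - 1)"] ch[of "i - 1"]
      by (metis Suc_diff_1 atLeastAtMost_iff less_eq_Suc_le One_nat_def)
    then show ?thesis
      using permutes_le[OF perm(1) True] permutes_le[OF perm(2) True] by linarith
  next
    case False
    then show ?thesis using perm by (auto simp: permutes_def)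
  qed
  then have "label t = label u" by (rule ext)
  moreover have "list_all2 (\<lambda>a b. \<exists>t u x y. a = t \<and> b = u \<and> t \<in> PT \<and> u \<in> PT
      \<and> ptree_at x t = ptree_at y u) (children t) (children u)"
    using n ch PT_D(2)[OF Eq_tree(1)] PT_D(2)[OF Eq_tree(2)]
    by (intro list_all2_all_nthI) force+
  ultimately show ?case by (auto elim!: list_all2_mono)
qed

primcorec decode :: "bt \<Rightarrow> ptree" where
  "decode T = Node
     (\<lambda>i. if i \<in> {1..lams T}
       then lams T - (hd_var (args T ! (i - 1)) - lams (args T ! (i - 1))) else i)
     (map decode (args T))"

lemma HPT_varD:
  assumes "HPT_var x T"
  obtains \<pi> n Ts where "\<pi> permutes {1..n}" "T = Hnf n (x + n) Ts" "length Ts = n"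
    "\<And>i. i < n \<Longrightarrow> HPT_var (n - \<pi> (Suc i)) (Ts ! i)" "label (decode T) = \<pi>"
proof -
  from assms obtain \<pi> n Ts where *: "\<pi> permutes {1..n}" "T = Hnf n (x + n) Ts" "length Ts = n"
    and ch: "\<forall>i\<in>{1..n}. HPT_var (n - \<pi> i) (Ts ! (i - 1))"
    by (auto elim: HPT_var.cases)
  have "hd_var T - lams T = x" if "HPT_var x T" for x T
    using that by (auto elim: HPT_var.cases)
  then have hd: "hd_var (Ts ! (i - 1)) - lams (Ts ! (i - 1)) = n - \<pi> i" if "i \<in> {1..n}" for i
    using ch that by blast
  have "label (decode T) i = \<pi> i" for i
  proof (cases "i \<in> {1..n}")
    case True
    then show ?thesis using hd[OF True] permutes_le[OF *(1) True] by (simp add: *(2))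
  next
    case False
    then show ?thesis using *(1) by (auto simp: *(2) permutes_def)
  qed
  then have "label (decode T) = \<pi>" by (rule ext)
  then show ?thesis using that * ch by force
qed

lemma decode_PT: "HPT_var x T \<Longrightarrow> decode T \<in> PT"
proof (coinduction arbitrary: x T rule: PT.coinduct)
  case (PT x T)
  then obtain \<pi> n Ts where *: "\<pi> permutes {1..n}" "T = Hnf n (x + n) Ts" "length Ts = n"
    "\<And>i. i < n \<Longrightarrow> HPT_var (n - \<pi> (Suc i)) (Ts ! i)" "label (decode T) = \<pi>"
    by (rule HPT_varD) blast
  have "decode T = Node \<pi> (map decode Ts)"
    using *(2,5) by (metis bt.sel(3) decode.simps(2) tree.collapse)
  moreover have "\<forall>t\<in>set (map decode Ts). \<exists>x T. t = decode T \<and> HPT_var x T"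
    using *(3,4) by (fastforce simp: in_set_conv_nth)
  moreover have "\<pi> permutes {1..length (map decode Ts)}" using *(1,3) by simp
  ultimately show ?case by blast
qed

lemma ptree_at_decode: "HPT_var x T \<Longrightarrow> ptree_at x (decode T) = T"
proof (coinduction arbitrary: x T rule: bt.coinduct_strong)
  case (Eq_bt x T)
  then obtain \<pi> n Ts where *: "\<pi> permutes {1..n}" "T = Hnf n (x + n) Ts" "length Ts = n"
    "\<And>i. i < n \<Longrightarrow> HPT_var (n - \<pi> (Suc i)) (Ts ! i)" "label (decode T) = \<pi>"
    by (rule HPT_varD) blast
  have "list_all2 (\<lambda>a b. \<exists>x T. a = ptree_at x (decode T) \<and> b = T \<and> HPT_var x T)
      (args (ptree_at x (decode T))) (args T)"
    using * by (intro list_all2_all_nthI) (auto simp del: upt_Suc decode.simps(1))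
  then show ?case
    using * by (auto elim!: list_all2_mono)
qed

theorem bij_betw_ptree_bt: "bij_betw ptree_bt PT HPT"
proof (rule bij_betwI')
  fix t u assume *: "t \<in> PT" "u \<in> PT"
  show "ptree_bt t = ptree_bt u \<longleftrightarrow> t = u"
    using ptree_at_inj[OF *] bt_app_ptree_bt * by metis
next
  fix t assume "t \<in> PT"
  then show "ptree_bt t \<in> HPT" using HPT_var_ptree_at by (auto simp: HPT_def ptree_bt_def)
next
  fix T assume "T \<in> HPT"
  then obtain S where "T = bt_Lam S" "HPT_var 0 S" by (auto simp: HPT_def)
  then show "\<exists>t\<in>PT. T = ptree_bt t"
    using decode_PT ptree_at_decode by (metis ptree_bt_def)
qed

text \<open>For \<^term>\<open>M \<in> HP\<close> this is well defined by \<open>bij_betw_ptree_bt\<close>.\<close>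

definition tree_of :: "tm \<Rightarrow> ptree" where
  "tree_of M = (THE t. t \<in> PT \<and> ptree_bt t = BT M)"

end

(* The terms are interpreted in a relational model, presented as a non-idempotent intersection
   type system with an atom satisfying star = [star] -> star.  A term has a beta normal form iff
   it has a typing in which the empty multiset occurs in no position that demands an argument, so
   terms with the same typings are equal in H+.  Since derivations have a size that head reduction
   does not increase, the typings of a hereditary permutation can be read off its tree: they form
   a binary relation on types, defined by induction, which is the identity for finite
   eta-expansions of the identity and hence invariant under similarity of trees.

   Conversely, applying a hereditary permutation to a selector extracts a child applied to one of
   the remaining arguments.  Two H+-equal terms must therefore pass the same argument to each
   child, have H+-equal children, and any surplus child is H+-equal to the identity; such a
   child has a normal form, hence a finite tree, all of whose labels are identities. *)

theory Submission
  imports Defs "HOL-Library.Multiset" "HOL-Library.Countable_Set" "HOL-Library.Product_Plus"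
begin

section \<open>Types\<close>

text \<open>The observation is a full normal form, so typability alone, which only sees head normal
  forms, is too coarse; the predicates \<open>pos\<close> and \<open>neg\<close> refine it. The atom
  has to be both, so that a variable can start a derivation on either side; this is why its argument
  multiset is the singleton \<open>{#0#}\<close>, since with \<open>{#}\<close> it would not be
  \<open>neg\<close>. As \<open>arr\<close> is a bijection, any type offers as many arguments as
  wanted, and trees of different width can be compared by reading missing children as leaves.

  The obstacle is infinity: neither Boehm trees nor permutation trees admit induction. Finite
  derivations replace it, and the descent into an infinite branch ends at an empty multiset. This is
  also what tells an infinite eta-expansion from the identity, because such a multiset is forbidden
  in \<open>neg\<close> positions.

  Separating contexts are evaluated in the model rather than by reduction: \<open>sem_HP t M\<close>
  records that \<open>M\<close> has the typings of \<open>t\<close>, and a context acts on typings.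
  All three conditions of the theorem are compared with one coinductive relation,
  \<open>sim\<close>.\<close>

lemma ex_bij_arr: "\<exists>f :: nat multiset \<times> nat \<Rightarrow> nat. bij f \<and> f ({#0#}, 0) = 0"
proof -
  let ?U = "UNIV :: (nat multiset \<times> nat) set"
  have "range (mset :: nat list \<Rightarrow> nat multiset) = UNIV"
    by (metis ex_mset surjI)
  then have "countable (UNIV :: nat multiset set)"
    by (metis countable_image countableI_type)
  then have "countable ?U"
    using countable_SIGMA[of "UNIV :: nat multiset set" "\<lambda>_. UNIV :: nat set"] by simp
  moreover have "infinite ?U"
    by (simp add: finite_prod)
  ultimately have g: "bij (to_nat_on ?U)"
    by (rule to_nat_on_infinite)
  \<comment> \<open>The enumeration is arbitrary; swapping the code of \<open>({#0#}, 0)\<close>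
    with \<open>0\<close> forces the equation for the atom and keeps bijectivity.\<close>
  let ?f = "transpose (to_nat_on ?U ({#0#}, 0)) 0 \<circ> to_nat_on ?U"
  have "bij ?f"
    using g by (intro bij_comp) auto
  then show ?thesis
    by (intro exI[of _ ?f]) simp
qed

text \<open>Types are coded as natural numbers, with the atom \<open>0\<close>: every type is an arrow in exactly one
  way, so there is room for unrestricted \<open>\<eta>\<close>-expansion.\<close>

definition arr :: "nat multiset \<Rightarrow> nat \<Rightarrow> nat" where
  "arr = curry (SOME f. bij f \<and> f ({#0#}, 0) = 0)"

lemma arr_props: "bij (case_prod arr) \<and> case_prod arr ({#0#}, 0) = 0"
  unfolding arr_def case_prod_curry using someI_ex[OF ex_bij_arr] .

lemma arr_star [simp]: "arr {#0#} 0 = 0"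
  using arr_props by simp

lemma arr_inject [simp]: "arr \<mu> \<sigma> = arr \<nu> \<tau> \<longleftrightarrow> \<mu> = \<nu> \<and> \<sigma> = \<tau>"
  using arr_props by (auto simp: bij_def inj_def)

lemma arr_cases: obtains \<mu> \<sigma> where "\<tau> = arr \<mu> \<sigma>"
  using arr_props by (metis bij_def prod.collapse case_prod_conv surjD)

abbreviation arrs :: "nat multiset list \<Rightarrow> nat \<Rightarrow> nat" where
  "arrs \<mu>s \<tau> \<equiv> foldr arr \<mu>s \<tau>"

lemma arrs_inject [simp]:
  "length \<mu>s = length \<nu>s \<Longrightarrow> arrs \<mu>s \<sigma> = arrs \<nu>s \<tau> \<longleftrightarrow> \<mu>s = \<nu>s \<and> \<sigma> = \<tau>"
  by (induction \<mu>s \<nu>s rule: list_induct2) auto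

lemma arrs_cases: obtains \<mu>s \<sigma> where "length \<mu>s = k" "\<tau> = arrs \<mu>s \<sigma>"
proof -
  have "\<exists>\<mu>s \<sigma>. length \<mu>s = k \<and> \<tau> = arrs \<mu>s \<sigma>"
  proof (induction k arbitrary: \<tau>)
    case (Suc k)
    obtain \<mu> \<sigma> where "\<tau> = arr \<mu> \<sigma>" by (rule arr_cases)
    moreover obtain \<mu>s \<sigma>' where "length \<mu>s = k" "\<sigma> = arrs \<mu>s \<sigma>'" using Suc by blast
    ultimately show ?case by (intro exI[of _ "\<mu> # \<mu>s"]) auto
  qed auto
  then show ?thesis using that by blast
qed

text \<open>The empty multiset occurs at no positive (\<open>pos\<close>) or no negative (\<open>neg\<close>) position of a type.
  These predicates are coinductive because \<open>0 = arr {#0#} 0\<close> unfolds forever.\<close>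

coinductive pos neg where
  "\<forall>\<sigma>\<in>#\<mu>. neg \<sigma> \<Longrightarrow> pos \<tau> \<Longrightarrow> pos (arr \<mu> \<tau>)"
| "\<mu> \<noteq> {#} \<Longrightarrow> \<forall>\<sigma>\<in>#\<mu>. pos \<sigma> \<Longrightarrow> neg \<tau> \<Longrightarrow> neg (arr \<mu> \<tau>)"

lemma pos_arr [simp]: "pos (arr \<mu> \<tau>) \<longleftrightarrow> (\<forall>\<sigma>\<in>#\<mu>. neg \<sigma>) \<and> pos \<tau>"
  by (subst pos.simps) auto

lemma neg_arr [simp]: "neg (arr \<mu> \<tau>) \<longleftrightarrow> \<mu> \<noteq> {#} \<and> (\<forall>\<sigma>\<in>#\<mu>. pos \<sigma>) \<and> neg \<tau>"
  by (subst neg.simps) auto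

lemma pos_star [simp]: "pos 0" and neg_star [simp]: "neg 0"
proof -
  have "(\<forall>x. x = 0 \<longrightarrow> pos x) \<and> (\<forall>x. x = 0 \<longrightarrow> neg x)"
    by (rule pos_neg.coinduct) (auto intro!: exI[of _ "{#0#}"] exI[of _ "0 :: nat"])
  then show "pos 0" "neg 0" by auto
qed

lemma pos_arrs: "pos (arrs \<mu>s \<tau>) \<longleftrightarrow> (\<forall>\<mu>\<in>set \<mu>s. \<forall>\<sigma>\<in>#\<mu>. neg \<sigma>) \<and> pos \<tau>"
  by (induction \<mu>s) auto

lemma neg_arrs:
  "neg (arrs \<mu>s \<tau>) \<longleftrightarrow> (\<forall>\<mu>\<in>set \<mu>s. \<mu> \<noteq> {#} \<and> (\<forall>\<sigma>\<in>#\<mu>. pos \<sigma>)) \<and> neg \<tau>"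
  by (induction \<mu>s) auto

section \<open>Typing\<close>

text \<open>A sum over a multiset in which every occurrence picks its own summand among those that
  \<open>P\<close> allows: equal types in an argument multiset may have different derivations. The
  monoid is generic because both sized weights and bare environments are summed.\<close>

inductive collect :: "('a \<Rightarrow> 'c::comm_monoid_add \<Rightarrow> bool) \<Rightarrow> 'c \<Rightarrow> 'a multiset \<Rightarrow> bool" for P where
  collect_0: "collect P 0 {#}"
| collect_add: "P a c \<Longrightarrow> collect P d A \<Longrightarrow> collect P (c + d) (add_mset a A)"

lemma collect_empty [simp]: "collect P c {#} \<longleftrightarrow> c = 0"
  by (auto elim: collect.cases intro: collect.intros)

text \<open>The rule inserts elements in some order; exchanging two insertions brings any chosen
  occurrence to the front.\<close>

lemma collect_add_mset:
  "collect P c (add_mset a A) \<longleftrightarrow> (\<exists>d e. c = d + e \<and> P a d \<and> collect P e A)"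
proof
  assume "collect P c (add_mset a A)"
  then show "\<exists>d e. c = d + e \<and> P a d \<and> collect P e A"
  proof (induction c "add_mset a A" arbitrary: A)
    case (collect_add b c d B)
    show ?case
    proof (cases "a = b")
      case True
      then show ?thesis using collect_add by auto
    next
      case False
      then obtain C where C: "B = add_mset a C" "A = add_mset b C"
        using collect_add(4) by (metis add_eq_conv_ex)
      with collect_add(3) obtain d' e where "d = d' + e" "P a d'" "collect P e C" by blast
      then have "c + d = d' + (c + e) \<and> P a d' \<and> collect P (c + e) A"
        using C collect_add(1) by (auto intro: collect.intros simp: ac_simps)
      then show ?thesis by blast
    qed
  qed simp
qed (auto intro: collect.intros)

lemma collect_single [simp]: "collect P c {#a#} \<longleftrightarrow> P a c"
  by (auto simp: collect_add_mset)

lemma collect_union: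
  "collect P c (A + B) \<longleftrightarrow> (\<exists>d e. c = d + e \<and> collect P d A \<and> collect P e B)"
proof (induction A arbitrary: c)
  case (add a A)
  show ?case by (auto simp: collect_add_mset add) (metis add.assoc)+
qed simp

lemma collect_image_mset: "collect P c (image_mset f A) \<longleftrightarrow> collect (P \<circ> f) c A"
  by (induction A arbitrary: c) (auto simp: collect_add_mset)

text \<open>Pairs of variable and type, each standing for one typed occurrence of the variable.
  Adding environments is then plain multiset sum, and finite support is automatic.\<close>

type_synonym env = "(nat \<times> nat) multiset"

definition at :: "nat \<Rightarrow> env \<Rightarrow> nat multiset" where
  "at i \<Gamma> = image_mset snd (filter_mset (\<lambda>p. fst p = i) \<Gamma>)"

text \<open>The environment that remains after leaving \<open>k\<close> binders; what it drops is
  read off by \<open>at\<close> as argument multisets.\<close>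

definition down :: "nat \<Rightarrow> env \<Rightarrow> env" where
  "down k \<Gamma> = image_mset (map_prod (\<lambda>i. i - k) id) (filter_mset (\<lambda>p. fst p \<ge> k) \<Gamma>)"

definition ren :: "(nat \<Rightarrow> nat) \<Rightarrow> env \<Rightarrow> env" where
  "ren f = image_mset (map_prod f id)"

lemma at_simps [simp]:
  "at i {#} = {#}" "at i (\<Gamma> + \<Delta>) = at i \<Gamma> + at i \<Delta>"
  "at i (add_mset (j, \<sigma>) \<Gamma>) = (if i = j then add_mset \<sigma> (at i \<Gamma>) else at i \<Gamma>)"
  by (auto simp: at_def)

lemma down_simps [simp]:
  "down k {#} = {#}" "down k (\<Gamma> + \<Delta>) = down k \<Gamma> + down k \<Delta>"
  "down k (add_mset (j, \<sigma>) \<Gamma>) = (if k \<le> j then add_mset (j - k, \<sigma>) (down k \<Gamma>) else down k \<Gamma>)"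
  by (auto simp: down_def)

lemma ren_simps [simp]:
  "ren f {#} = {#}" "ren f (\<Gamma> + \<Delta>) = ren f \<Gamma> + ren f \<Delta>"
  "ren f (add_mset (j, \<sigma>) \<Gamma>) = add_mset (f j, \<sigma>) (ren f \<Gamma>)"
  by (auto simp: ren_def)

lemma env_induct [case_names empty add]:
  assumes "P {#}" "\<And>i \<sigma> \<Gamma>. P \<Gamma> \<Longrightarrow> P (add_mset (i, \<sigma>) \<Gamma>)"
  shows "P (\<Gamma> :: env)"
  using assms by (induction \<Gamma>) auto

lemma down_0 [simp]: "down 0 \<Gamma> = \<Gamma>"
  by (induction \<Gamma> rule: env_induct) auto

lemma down_down: "down j (down k \<Gamma>) = down (k + j) \<Gamma>"
  by (induction \<Gamma> rule: env_induct) auto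

lemma at_down: "at i (down k \<Gamma>) = at (i + k) \<Gamma>"
  by (induction \<Gamma> rule: env_induct) auto

lemma ren_lift: "at 0 (ren (lift_ren 1 f) \<Gamma>) = at 0 \<Gamma>"
    "down 1 (ren (lift_ren 1 f) \<Gamma>) = ren f (down 1 \<Gamma>)"
  by (induction \<Gamma> rule: env_induct) (auto simp: lift_ren_def)

text \<open>A weight consists of the size of a derivation and of its environment.\<close>

primrec ty :: "tm \<Rightarrow> nat \<Rightarrow> nat \<times> env \<Rightarrow> bool" where
  "ty (Var x) \<tau> w \<longleftrightarrow> w = (0, {#(x, \<tau>)#})"
| "ty (App M N) \<tau> w \<longleftrightarrow>
    (\<exists>w1 w2 \<mu>. w = (1, 0) + w1 + w2 \<and> ty M (arr \<mu> \<tau>) w1 \<and> collect (ty N) w2 \<mu>)"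
| "ty (Lam M) \<tau> w \<longleftrightarrow>
    (\<exists>n \<Gamma> \<sigma>. w = (Suc n, down 1 \<Gamma>) \<and> \<tau> = arr (at 0 \<Gamma>) \<sigma> \<and> ty M \<sigma> (n, \<Gamma>))"

section \<open>Renaming and substitution\<close>

lemma collect_rename:
  assumes "\<And>\<sigma> n \<Delta>. P \<sigma> (n, \<Delta>) \<longleftrightarrow> (\<exists>\<Gamma>. \<Delta> = ren f \<Gamma> \<and> Q \<sigma> (n, \<Gamma>))"
  shows "collect P (n, \<Delta>) \<mu> \<longleftrightarrow> (\<exists>\<Gamma>. \<Delta> = ren f \<Gamma> \<and> collect Q (n, \<Gamma>) \<mu>)"
proof (induction \<mu> arbitrary: n \<Delta>)
  case (add \<sigma> \<mu>)
  show ?case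
    by (simp add: collect_add_mset assms add split_paired_Ex) (metis ren_simps(2))
qed (auto simp: zero_prod_def)

lemma ty_rename: "ty (rename f M) \<tau> (n, \<Delta>) \<longleftrightarrow> (\<exists>\<Gamma>. \<Delta> = ren f \<Gamma> \<and> ty M \<tau> (n, \<Gamma>))"
proof (induction M arbitrary: f \<tau> n \<Delta>)
  case (Var x)
  then show ?case by auto
next
  case (App M N)
  show ?case
    by (simp add: split_paired_Ex App collect_rename[OF App(2)]) (metis ren_simps(2))
next
  case (Lam M)
  show ?case
    by (simp add: Lam) (metis ren_lift One_nat_def)
qed

text \<open>A typed substitution: each entry of the environment asks for a derivation of its own for
  the substituted term.\<close>

definition sty :: "(nat \<Rightarrow> tm) \<Rightarrow> nat \<times> env \<Rightarrow> env \<Rightarrow> bool" where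
  "sty \<theta> = collect (\<lambda>(i, \<sigma>). ty (\<theta> i) \<sigma>)"

lemma env_split: "\<Gamma> = image_mset (Pair 0) (at 0 \<Gamma>) + ren Suc (down 1 \<Gamma>)"
  by (induction \<Gamma> rule: env_induct) auto

lemma at_down_ren_Suc [simp]: "at 0 (ren Suc \<Gamma>) = {#}" "down (Suc 0) (ren Suc \<Gamma>) = \<Gamma>"
  by (induction \<Gamma> rule: env_induct) auto

lemma at_down_image_Pair [simp]:
  "at i (image_mset (Pair j) \<mu>) = (if i = j then \<mu> else {#})"
  "down k (image_mset (Pair j) \<mu>) = (if k \<le> j then image_mset (Pair (j - k)) \<mu> else {#})"
  by (induction \<mu>) auto

lemma collect_Var: "collect (\<lambda>(i, \<sigma>). ty (Var (f i)) \<sigma>) w \<Gamma> \<longleftrightarrow> w = (0, ren f \<Gamma>)"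
  by (induction \<Gamma> arbitrary: w rule: env_induct) (auto simp: collect_add_mset zero_prod_def)

lemma collect_Var_type: "collect (ty (Var x)) w \<mu> \<longleftrightarrow> w = (0, image_mset (Pair x) \<mu>)"
  by (induction \<mu> arbitrary: w) (auto simp: collect_add_mset zero_prod_def)

lemma ren_id [simp]: "ren (\<lambda>i. i) \<Gamma> = \<Gamma>"
  by (induction \<Gamma> rule: env_induct) auto

lemma sty_case_nat:
  "sty (case_nat N \<theta>) w \<Gamma> \<longleftrightarrow>
    (\<exists>w1 w2. w = w1 + w2 \<and> collect (ty N) w1 (at 0 \<Gamma>) \<and> sty \<theta> w2 (down 1 \<Gamma>))"
proof -
  have "(\<lambda>(i, \<sigma>). ty (case_nat N \<theta> i) \<sigma>) \<circ> Pair 0 = ty N"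
    "(\<lambda>(i, \<sigma>). ty (case_nat N \<theta> i) \<sigma>) \<circ> map_prod Suc id = (\<lambda>(i, \<sigma>). ty (\<theta> i) \<sigma>)"
    by auto
  then show ?thesis
    unfolding sty_def by (subst env_split) (simp add: collect_union collect_image_mset ren_def)
qed

text \<open>The new variable is mapped to itself, and a variable has derivations of size 0; so the
  size is unchanged and the entries at \<open>0\<close> merely reappear.\<close>

lemma sty_up:
  "sty (case_nat (Var 0) (\<lambda>i. rename Suc (\<theta> i))) (n, \<Delta>') \<Gamma> \<longleftrightarrow>
    (\<exists>\<Delta>. \<Delta>' = image_mset (Pair 0) (at 0 \<Gamma>) + ren Suc \<Delta> \<and> sty \<theta> (n, \<Delta>) (down 1 \<Gamma>))"
proof -
  have "sty (\<lambda>i. rename Suc (\<theta> i)) (n, \<Delta>) \<Gamma> \<longleftrightarrow> (\<exists>\<Delta>'. \<Delta> = ren Suc \<Delta>' \<and> sty \<theta> (n, \<Delta>') \<Gamma>)"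
    for n \<Delta> \<Gamma>
    unfolding sty_def by (rule collect_rename) (auto simp: ty_rename)
  note ren = this
  show ?thesis (is "?l \<longleftrightarrow> ?r")
  proof
    assume ?l
    then show ?r by (auto simp: sty_case_nat collect_Var_type ren)
  next
    assume ?r
    then obtain \<Delta> where "(n, \<Delta>') = (0, image_mset (Pair 0) (at 0 \<Gamma>)) + (n, ren Suc \<Delta>)"
      "sty (\<lambda>i. rename Suc (\<theta> i)) (n, ren Suc \<Delta>) (down 1 \<Gamma>)"
      by (auto simp: ren)
    then show ?l
      unfolding sty_case_nat collect_Var_type by blast
  qed
qed

lemma ty_AppI:
  assumes "ty M (arr \<mu> \<tau>) (n, \<Gamma>)" "collect (ty N) (m, \<Delta>) \<mu>"
  shows "ty (App M N) \<tau> (Suc (n + m), \<Gamma> + \<Delta>)"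
  unfolding ty.simps
  by (intro exI[of _ "(n, \<Gamma>)"] exI[of _ "(m, \<Delta>)"] exI[of _ \<mu>]) (use assms in simp)

lemma collect_subst:
  assumes "\<And>\<sigma> w. P \<sigma> w \<longleftrightarrow> (\<exists>n \<Gamma> v. w = (n, 0) + v \<and> Q \<sigma> (n, \<Gamma>) \<and> sty \<theta> v \<Gamma>)"
  shows "collect P w \<mu> \<longleftrightarrow> (\<exists>n \<Gamma> v. w = (n, 0) + v \<and> collect Q (n, \<Gamma>) \<mu> \<and> sty \<theta> v \<Gamma>)"
proof (induction \<mu> arbitrary: w)
  case empty
  show ?case by (auto simp: zero_prod_def sty_def)
next
  case (add \<sigma> \<mu>)
  show ?case (is "?l \<longleftrightarrow> ?r")
  proof
    assume ?l
    then obtain d e where "w = d + e" "P \<sigma> d" "collect P e \<mu>"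
      unfolding collect_add_mset by blast
    moreover from this(2) obtain n \<Gamma> v where "d = (n, 0) + v" "Q \<sigma> (n, \<Gamma>)" "sty \<theta> v \<Gamma>"
      unfolding assms by blast
    moreover from calculation(3) obtain n' \<Gamma>' v' where
      "e = (n', 0) + v'" "collect Q (n', \<Gamma>') \<mu>" "sty \<theta> v' \<Gamma>'"
      unfolding add.IH by blast
    ultimately have "w = ((n, 0) + v) + ((n', 0) + v')"
      "Q \<sigma> (n, \<Gamma>)" "sty \<theta> v \<Gamma>" "collect Q (n', \<Gamma>') \<mu>" "sty \<theta> v' \<Gamma>'"
      by auto
    then show ?r
      by (intro exI[of _ "n + n'"] exI[of _ "\<Gamma> + \<Gamma>'"] exI[of _ "v + v'"])
        (simp add: collect_add_mset sty_def collect_union prod_eq_iff del: split_paired_Ex, fastforce)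
  next
    assume ?r
    then obtain n \<Gamma> v n' \<Gamma>' v' where "w = (n + n', 0) + (v + v')"
      "Q \<sigma> (n, \<Gamma>)" "sty \<theta> v \<Gamma>" "collect Q (n', \<Gamma>') \<mu>" "sty \<theta> v' \<Gamma>'"
      unfolding sty_def by (auto simp: collect_add_mset collect_union simp del: split_paired_Ex)
    moreover from this have "w = ((n, 0) + v) + ((n', 0) + v')"
      by (simp add: prod_eq_iff)
    ultimately show ?l
      unfolding collect_add_mset using assms add.IH by blast
  qed
qed

text \<open>A variable leaf has size 0 and carries exactly one entry of the environment, so grafting
  one derivation on each entry adds sizes exactly. Conversely, a derivation for the substituted term
  can be cut at the grafting points.\<close>

lemma ty_subst:
  "ty (subst \<theta> M) \<tau> w \<longleftrightarrow> (\<exists>n \<Gamma> v. w = (n, 0) + v \<and> ty M \<tau> (n, \<Gamma>) \<and> sty \<theta> v \<Gamma>)"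
proof (induction M arbitrary: \<theta> \<tau> w)
  case (Var x)
  show ?case by (auto simp: sty_def prod_eq_iff)
next
  case (App M N)
  show ?case (is "?l \<longleftrightarrow> ?r")
  proof
    assume ?l
    then obtain n \<Gamma> v n' \<Gamma>' v' \<mu> where "w = (1, 0) + ((n, 0) + v) + ((n', 0) + v')"
      "ty M (arr \<mu> \<tau>) (n, \<Gamma>)" "sty \<theta> v \<Gamma>" "collect (ty N) (n', \<Gamma>') \<mu>" "sty \<theta> v' \<Gamma>'"
      unfolding subst.simps ty.simps App(1) collect_subst[OF App(2)] by blast
    moreover from this have "ty (App M N) \<tau> (Suc (n + n'), \<Gamma> + \<Gamma>')"
      by (intro ty_AppI)
    ultimately show ?r
      by (intro exI[of _ "Suc (n + n')"] exI[of _ "\<Gamma> + \<Gamma>'"] exI[of _ "v + v'"])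
        (simp add: sty_def collect_union prod_eq_iff del: ty.simps split_paired_Ex, blast)
  next
    assume ?r
    then obtain n \<Gamma> v n' \<Gamma>' v' \<mu> where "w = (Suc (n + n'), 0) + (v + v')"
      "ty M (arr \<mu> \<tau>) (n, \<Gamma>)" "sty \<theta> v \<Gamma>" "collect (ty N) (n', \<Gamma>') \<mu>" "sty \<theta> v' \<Gamma>'"
      by (auto simp: sty_def collect_union simp del: split_paired_Ex)
    moreover from this have "w = (1, 0) + ((n, 0) + v) + ((n', 0) + v')"
      by (simp add: prod_eq_iff)
    ultimately show ?l
      unfolding subst.simps ty.simps App(1) collect_subst[OF App(2)] by blast
  qed
next
  case (Lam M)
  show ?case (is "?l \<longleftrightarrow> ?r")
  proof
    assume ?l
    then obtain n \<Gamma> n' \<Delta> \<sigma> where "w = (Suc (n + n'), \<Delta>)" "\<tau> = arr (at 0 \<Gamma>) \<sigma>"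
      "ty M \<sigma> (n, \<Gamma>)" "sty \<theta> (n', \<Delta>) (down 1 \<Gamma>)"
      by (auto simp: Lam sty_up)
    then show ?r
      by (intro exI[of _ "Suc n"] exI[of _ "down 1 \<Gamma>"] exI[of _ "(n', \<Delta>)"]) auto
  next
    assume ?r
    then obtain n \<Gamma> n' \<Delta> \<sigma> where *: "w = (Suc (n + n'), \<Delta>)" "\<tau> = arr (at 0 \<Gamma>) \<sigma>"
      "ty M \<sigma> (n, \<Gamma>)" "sty \<theta> (n', \<Delta>) (down 1 \<Gamma>)"
      by auto
    let ?\<Delta> = "image_mset (Pair 0) (at 0 \<Gamma>) + ren Suc \<Delta>"
    have "ty (subst (case_nat (Var 0) (\<lambda>i. rename Suc (\<theta> i))) M) \<sigma> (n + n', ?\<Delta>)"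
      unfolding Lam by (intro exI[of _ n] exI[of _ \<Gamma>] exI[of _ "(n', ?\<Delta>)"]) (use * sty_up in auto)
    then show ?l
      using *(1,2)
      by (simp only: subst.simps ty.simps) (intro exI[of _ "n + n'"] exI[of _ ?\<Delta>] exI[of _ \<sigma>], simp)
  qed
qed

text \<open>The \<open>2\<close> counts the application and the abstraction that disappear. The
  equivalence yields subject reduction, subject expansion and the decrease along weak head
  steps.\<close>

lemma ty_redex:
  "ty (App (Lam M) N) \<tau> w \<longleftrightarrow> (\<exists>v. w = (2, 0) + v \<and> ty (subst0 M N) \<tau> v)"
proof -
  have Var: "sty Var v \<Gamma> \<longleftrightarrow> v = (0, \<Gamma>)" for v \<Gamma>
    using collect_Var[of "\<lambda>i. i" v \<Gamma>] by (simp add: sty_def)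
  show ?thesis (is "?l \<longleftrightarrow> ?r")
  proof
    assume ?l
    then obtain n \<Gamma> v where "w = (1, 0) + (Suc n, down 1 \<Gamma>) + v" "ty M \<tau> (n, \<Gamma>)"
      "collect (ty N) v (at 0 \<Gamma>)"
      by auto
    moreover from this have "ty (subst0 M N) \<tau> ((n, 0) + (v + (0, down 1 \<Gamma>)))"
      unfolding ty_subst sty_case_nat Var by blast
    ultimately show ?r
      by (intro exI[of _ "(n, 0) + (v + (0, down 1 \<Gamma>))"]) (simp add: prod_eq_iff)
  next
    assume ?r
    then obtain n \<Gamma> v where "w = (1, 0) + (Suc n, down 1 \<Gamma>) + v" "ty M \<tau> (n, \<Gamma>)"
      "collect (ty N) v (at 0 \<Gamma>)"
      unfolding ty_subst sty_case_nat Var by (fastforce simp: prod_eq_iff ac_simps)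
    then show ?l
      by (simp only: ty.simps) blast
  qed
qed

section \<open>Typings without sizes and their invariance under beta\<close>

definition typable :: "tm \<Rightarrow> nat \<Rightarrow> env \<Rightarrow> bool" where
  "typable M \<tau> \<Gamma> \<longleftrightarrow> (\<exists>n. ty M \<tau> (n, \<Gamma>))"

lemma ex_size_collect:
  "(\<exists>n. collect P (n, \<Gamma>) \<mu>) \<longleftrightarrow> collect (\<lambda>\<sigma> \<Gamma>. \<exists>n. P \<sigma> (n, \<Gamma>)) \<Gamma> \<mu>"
proof (induction \<mu> arbitrary: \<Gamma>)
  case (add \<sigma> \<mu>)
  have "(\<exists>n. collect P (n, \<Gamma>) (add_mset \<sigma> \<mu>)) \<longleftrightarrow>
      (\<exists>\<Delta> \<Delta>'. \<Gamma> = \<Delta> + \<Delta>' \<and> (\<exists>n. P \<sigma> (n, \<Delta>)) \<and> (\<exists>n. collect P (n, \<Delta>') \<mu>))"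
    by (auto simp: collect_add_mset)
  then show ?case by (simp add: collect_add_mset add)
qed (simp add: zero_prod_def)

lemma typable_Var [simp]: "typable (Var x) \<tau> \<Gamma> \<longleftrightarrow> \<Gamma> = {#(x, \<tau>)#}"
  by (auto simp: typable_def)

lemma typable_App:
  "typable (App M N) \<tau> \<Gamma> \<longleftrightarrow>
    (\<exists>\<mu> \<Gamma>1 \<Gamma>2. \<Gamma> = \<Gamma>1 + \<Gamma>2 \<and> typable M (arr \<mu> \<tau>) \<Gamma>1 \<and> collect (typable N) \<Gamma>2 \<mu>)"
proof -
  have "typable N = (\<lambda>\<sigma> \<Gamma>. \<exists>n. ty N \<sigma> (n, \<Gamma>))"
    by (intro ext) (simp add: typable_def)
  then show ?thesis
    by (auto simp: typable_def ex_size_collect[symmetric] simp del: ty.simps(2) intro: ty_AppI)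
      (auto)
qed

lemma typable_Lam:
  "typable (Lam M) \<tau> \<Gamma> \<longleftrightarrow> (\<exists>\<Gamma>' \<sigma>. \<Gamma> = down 1 \<Gamma>' \<and> \<tau> = arr (at 0 \<Gamma>') \<sigma> \<and> typable M \<sigma> \<Gamma>')"
  by (auto simp: typable_def)

lemma typable_App_cong:
  "typable M = typable M' \<Longrightarrow> typable N = typable N' \<Longrightarrow> typable (App M N) = typable (App M' N')"
  by (intro ext) (simp add: typable_App)

lemma typable_Lam_cong: "typable M = typable M' \<Longrightarrow> typable (Lam M) = typable (Lam M')"
  by (intro ext) (simp add: typable_Lam)

lemma typable_fill_cong: "typable M = typable N \<Longrightarrow> typable (fill C M) = typable (fill C N)"
  by (induction C) (auto intro: typable_App_cong typable_Lam_cong)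

lemma typable_beta: "beta M N \<Longrightarrow> typable M = typable N"
proof (induction rule: beta.induct)
  case (1 M N)
  show ?case by (intro ext) (auto simp: typable_def ty_redex simp del: ty.simps)
qed (auto intro: typable_App_cong typable_Lam_cong)

lemma typable_betas: "beta\<^sup>*\<^sup>* M N \<Longrightarrow> typable M = typable N"
  by (induction rule: rtranclp_induct) (auto dest: typable_beta)

section \<open>Derivation sizes along reduction\<close>

lemma collect_size_le:
  fixes n :: nat
  assumes "collect P (n, \<Gamma>) \<mu>" "\<And>\<sigma> n \<Gamma>. P \<sigma> (n, \<Gamma>) \<Longrightarrow> \<exists>m\<le>n. Q \<sigma> (m, \<Gamma>)"
  shows "\<exists>m\<le>n. collect Q (m, \<Gamma>) \<mu>"
  using assms(1)
proof (induction \<mu> arbitrary: n \<Gamma> rule: multiset_induct)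
  case (add \<sigma> \<mu>)
  then obtain n1 \<Gamma>1 n2 \<Gamma>2 where *: "n = n1 + n2" "\<Gamma> = \<Gamma>1 + \<Gamma>2" "P \<sigma> (n1, \<Gamma>1)"
    "collect P (n2, \<Gamma>2) \<mu>"
    by (auto simp: collect_add_mset)
  from assms(2)[OF *(3)] add.IH[OF *(4)] obtain m1 m2 where
    "m1 \<le> n1" "Q \<sigma> (m1, \<Gamma>1)" "m2 \<le> n2" "collect Q (m2, \<Gamma>2) \<mu>"
    by blast
  then show ?case
    using * by (intro exI[of _ "m1 + m2"]) (auto simp: collect_add_mset add_mono)
qed (auto simp: zero_prod_def)

text \<open>The bound is not strict: a redex inside an argument typed by the empty multiset is
  contracted without a trace in the derivation.\<close>

lemma ty_beta: "beta M N \<Longrightarrow> ty M \<tau> (n, \<Gamma>) \<Longrightarrow> \<exists>m\<le>n. ty N \<tau> (m, \<Gamma>)"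
proof (induction arbitrary: \<tau> n \<Gamma> rule: beta.induct)
  case (1 M N)
  then obtain m where "n = Suc (Suc m)" "ty (subst0 M N) \<tau> (m, \<Gamma>)"
    unfolding ty_redex by auto
  then show ?case by (intro exI[of _ m]) simp
next
  case (2 M M' N)
  then obtain n1 \<Gamma>1 n2 \<Gamma>2 \<mu> where *: "n = Suc (n1 + n2)" "\<Gamma> = \<Gamma>1 + \<Gamma>2" "ty M (arr \<mu> \<tau>) (n1, \<Gamma>1)"
    "collect (ty N) (n2, \<Gamma>2) \<mu>"
    by auto
  from 2(2)[OF *(3)] obtain m where "m \<le> n1" "ty M' (arr \<mu> \<tau>) (m, \<Gamma>1)" by blast
  then show ?case using * by (intro exI[of _ "Suc (m + n2)"]) (auto intro!: ty_AppI simp del: ty.simps)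
next
  case (3 N N' M)
  then obtain n1 \<Gamma>1 n2 \<Gamma>2 \<mu> where *: "n = Suc (n1 + n2)" "\<Gamma> = \<Gamma>1 + \<Gamma>2" "ty M (arr \<mu> \<tau>) (n1, \<Gamma>1)"
    "collect (ty N) (n2, \<Gamma>2) \<mu>"
    by auto
  from collect_size_le[where Q = "ty N'", OF *(4) 3(2)]
  obtain m where "m \<le> n2" "collect (ty N') (m, \<Gamma>2) \<mu>" by blast
  then show ?case using * by (intro exI[of _ "Suc (n1 + m)"]) (auto intro!: ty_AppI simp del: ty.simps)
next
  case (4 M M')
  then obtain m \<Delta> \<sigma> where "n = Suc m" "\<Gamma> = down 1 \<Delta>" "\<tau> = arr (at 0 \<Delta>) \<sigma>" "ty M \<sigma> (m, \<Delta>)"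
    by auto
  moreover then obtain m' where "m' \<le> m" "ty M' \<sigma> (m', \<Delta>)" using 4(2) by blast
  ultimately show ?case by (intro exI[of _ "Suc m'"]) auto
qed

lemma ty_betas: "beta\<^sup>*\<^sup>* M N \<Longrightarrow> ty M \<tau> (n, \<Gamma>) \<Longrightarrow> \<exists>m\<le>n. ty N \<tau> (m, \<Gamma>)"
proof (induction rule: rtranclp_induct)
  case (step N N')
  then show ?case by (meson ty_beta order_trans)
qed auto

text \<open>A weak head redex never lies inside an argument, so every derivation types it and loses
  the weight of its application and abstraction.\<close>

lemma ty_weak_head: "weak_head M N \<Longrightarrow> ty M \<tau> (n, \<Gamma>) \<Longrightarrow> \<exists>m<n. ty N \<tau> (m, \<Gamma>)"
proof (induction arbitrary: \<tau> n \<Gamma> rule: weak_head.induct)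
  case (1 M N)
  then obtain m where "n = Suc (Suc m)" "ty (subst0 M N) \<tau> (m, \<Gamma>)"
    unfolding ty_redex by auto
  then show ?case by (intro exI[of _ m]) simp
next
  case (2 M M' N)
  then obtain n1 \<Gamma>1 n2 \<Gamma>2 \<mu> where *: "n = Suc (n1 + n2)" "\<Gamma> = \<Gamma>1 + \<Gamma>2" "ty M (arr \<mu> \<tau>) (n1, \<Gamma>1)"
    "collect (ty N) (n2, \<Gamma>2) \<mu>"
    by auto
  from 2(2)[OF *(3)] obtain m where "m < n1" "ty M' (arr \<mu> \<tau>) (m, \<Gamma>1)" by blast
  then show ?case using * by (intro exI[of _ "Suc (m + n2)"]) (auto intro!: ty_AppI simp del: ty.simps)
qed

lemma ty_foldl:
  "ty (foldl App H Ms) \<tau> w \<longleftrightarrow> (\<exists>\<mu>s v ws. length \<mu>s = length Ms \<and>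
    w = v + (length Ms, 0) + (\<Sum>j<length Ms. ws j) \<and> ty H (arrs \<mu>s \<tau>) v \<and>
    (\<forall>j<length Ms. collect (ty (Ms ! j)) (ws j) (\<mu>s ! j)))"
proof (induction Ms arbitrary: H)
  case Nil
  show ?case by (auto simp: prod_eq_iff)
next
  case (Cons M Ms)
  have Suc: "(Suc (length Ms), 0) = (1, 0) + (length Ms, 0 :: env)"
    by simp
  show ?case (is "?l \<longleftrightarrow> ?r")
  proof
    assume ?l
    then obtain \<mu>s v ws w' \<mu> where *: "length \<mu>s = length Ms"
      "w = ((1, 0) + v + w') + (length Ms, 0) + (\<Sum>j<length Ms. ws j)"
      "ty H (arr \<mu> (arrs \<mu>s \<tau>)) v" "collect (ty M) w' \<mu>"
      "\<forall>j<length Ms. collect (ty (Ms ! j)) (ws j) (\<mu>s ! j)"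
      unfolding foldl.simps Cons ty.simps by blast
    have "w = v + (length (M # Ms), 0) + (\<Sum>j<length (M # Ms). case_nat w' ws j)"
      unfolding *(2) length_Cons sum.lessThan_Suc_shift Suc by (simp only: nat.case ac_simps)
    moreover have "collect (ty ((M # Ms) ! j)) (case_nat w' ws j) ((\<mu> # \<mu>s) ! j)"
      if "j < length (M # Ms)" for j
      using that *(4,5) by (cases j) auto
    ultimately show ?r
      using *(1,3)
      by (intro exI[of _ "\<mu> # \<mu>s"] exI[of _ v] exI[of _ "case_nat w' ws"] conjI)
        (simp_all only: length_Cons foldr.simps o_apply simp_thms, blast)
  next
    assume ?r
    then obtain \<mu>s v ws where *: "length \<mu>s = Suc (length Ms)"
      "w = v + (Suc (length Ms), 0) + (\<Sum>j<Suc (length Ms). ws j)"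
      "ty H (arrs \<mu>s \<tau>) v"
      "\<forall>j<Suc (length Ms). collect (ty ((M # Ms) ! j)) (ws j) (\<mu>s ! j)"
      unfolding length_Cons by blast
    then obtain \<mu> \<nu>s where \<mu>s: "\<mu>s = \<mu> # \<nu>s" by (cases \<mu>s) auto
    have "ty (App H M) (arrs \<nu>s \<tau>) ((1, 0) + v + ws 0)"
      unfolding ty.simps
      by (intro exI[of _ v] exI[of _ "ws 0"] exI[of _ \<mu>]) (use * \<mu>s in auto)
    moreover have "w = ((1, 0) + v + ws 0) + (length Ms, 0) + (\<Sum>j<length Ms. ws (Suc j))"
      unfolding *(2) sum.lessThan_Suc_shift Suc by (simp only: ac_simps)
    moreover have "\<forall>j<length Ms. collect (ty (Ms ! j)) (ws (Suc j)) (\<nu>s ! j)"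
      using *(4) \<mu>s by auto
    ultimately show ?l
      unfolding foldl.simps Cons using *(1) \<mu>s
      by (intro exI[of _ \<nu>s] exI[of _ "(1, 0) + v + ws 0"] exI[of _ "\<lambda>j. ws (Suc j)"] conjI)
        (simp_all only: length_Cons nat.inject)
  qed
qed

text \<open>The outermost binder takes the first argument but has the largest de Bruijn index, hence
  \<open>k - 1 - j\<close>.\<close>

lemma ty_lams:
  "ty ((Lam ^^ k) M) \<tau> w \<longleftrightarrow> (\<exists>n \<Gamma> \<sigma>. w = (n + k, down k \<Gamma>) \<and>
    \<tau> = arrs (map (\<lambda>j. at (k - 1 - j) \<Gamma>) [0..<k]) \<sigma> \<and> ty M \<sigma> (n, \<Gamma>))"
proof (induction k arbitrary: \<tau> w)
  case 0
  show ?case by (cases w) auto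
next
  case (Suc k)
  have map: "map (\<lambda>j. at (k - j) \<Gamma>) [0..<Suc k] = at k \<Gamma> # map (\<lambda>j. at (k - 1 - j) \<Gamma>) [0..<k]" for \<Gamma>
    by (simp add: map_upt_Suc del: upt_Suc)
  show ?case (is "?l \<longleftrightarrow> ?r")
  proof
    assume ?l
    then obtain n \<Gamma> \<sigma> where "w = (Suc (n + k), down 1 (down k \<Gamma>))" "ty M \<sigma> (n, \<Gamma>)"
      "\<tau> = arr (at 0 (down k \<Gamma>)) (arrs (map (\<lambda>j. at (k - 1 - j) \<Gamma>) [0..<k]) \<sigma>)"
      unfolding funpow.simps o_apply ty.simps Suc by blast
    then show ?r
      by (intro exI[of _ n] exI[of _ \<Gamma>] exI[of _ \<sigma>]) (simp add: down_down at_down map del: upt_Suc)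
  next
    assume ?r
    then obtain n \<Gamma> \<sigma> where "w = (Suc (n + k), down 1 (down k \<Gamma>))" "ty M \<sigma> (n, \<Gamma>)"
      "\<tau> = arr (at 0 (down k \<Gamma>)) (arrs (map (\<lambda>j. at (k - 1 - j) \<Gamma>) [0..<k]) \<sigma>)"
      by (auto simp: down_down at_down map simp del: upt_Suc)
    then show ?l
      unfolding funpow.simps o_apply ty.simps Suc by blast
  qed
qed

lemma typable_lams:
  "typable ((Lam ^^ k) M) \<tau> \<Gamma> \<longleftrightarrow> (\<exists>\<Gamma>' \<sigma>. \<Gamma> = down k \<Gamma>' \<and>
    \<tau> = arrs (map (\<lambda>j. at (k - 1 - j) \<Gamma>') [0..<k]) \<sigma> \<and> typable M \<sigma> \<Gamma>')"
  unfolding typable_def ty_lams by blast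

lemma typable_foldl:
  "typable (foldl App H Ms) \<tau> \<Gamma> \<longleftrightarrow> (\<exists>\<mu>s \<Delta> \<Gamma>s. length \<mu>s = length Ms \<and>
    \<Gamma> = \<Delta> + (\<Sum>j<length Ms. \<Gamma>s j) \<and> typable H (arrs \<mu>s \<tau>) \<Delta> \<and>
    (\<forall>j<length Ms. collect (typable (Ms ! j)) (\<Gamma>s j) (\<mu>s ! j)))" (is "?l \<longleftrightarrow> ?r")
proof
  assume ?l
  then obtain n \<mu>s v ws where *: "length \<mu>s = length Ms"
    "(n, \<Gamma>) = v + (length Ms, 0) + (\<Sum>j<length Ms. ws j)" "ty H (arrs \<mu>s \<tau>) v"
    "\<forall>j<length Ms. collect (ty (Ms ! j)) (ws j) (\<mu>s ! j)"
    unfolding typable_def ty_foldl by blast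
  have "\<exists>n. collect (ty (Ms ! j)) (n, snd (ws j)) (\<mu>s ! j)" if "j < length Ms" for j
    using *(4) that by (intro exI[of _ "fst (ws j)"]) simp
  then have "collect (typable (Ms ! j)) (snd (ws j)) (\<mu>s ! j)" if "j < length Ms" for j
    using that unfolding ex_size_collect by (simp add: typable_def[abs_def])
  moreover have "\<Gamma> = snd v + (\<Sum>j<length Ms. snd (ws j))"
    using arg_cong[OF *(2), of snd] by (simp add: snd_sum)
  moreover have "typable H (arrs \<mu>s \<tau>) (snd v)"
    unfolding typable_def using *(3) by (intro exI[of _ "fst v"]) simp
  ultimately show ?r using *(1) by blast
next
  assume ?r
  then obtain \<mu>s \<Delta> \<Gamma>s where *: "length \<mu>s = length Ms"
    "\<Gamma> = \<Delta> + (\<Sum>j<length Ms. \<Gamma>s j)" "typable H (arrs \<mu>s \<tau>) \<Delta>"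
    "\<forall>j<length Ms. collect (typable (Ms ! j)) (\<Gamma>s j) (\<mu>s ! j)"
    by blast
  have "\<exists>n. collect (ty (Ms ! j)) (n, \<Gamma>s j) (\<mu>s ! j)" if "j < length Ms" for j
    using *(4) that unfolding ex_size_collect by (simp add: typable_def[abs_def])
  then obtain ns where ns: "\<forall>j<length Ms. collect (ty (Ms ! j)) (ns j, \<Gamma>s j) (\<mu>s ! j)"
    by metis
  obtain n where n: "ty H (arrs \<mu>s \<tau>) (n, \<Delta>)" using *(3) by (auto simp: typable_def)
  have "(n + length Ms + (\<Sum>j<length Ms. ns j), \<Gamma>) =
      (n, \<Delta>) + (length Ms, 0) + (\<Sum>j<length Ms. (ns j, \<Gamma>s j))"
    using *(2) by (simp add: prod_eq_iff fst_sum snd_sum)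
  then show ?l
    unfolding typable_def ty_foldl using *(1) n ns by blast
qed

section \<open>Typability characterizes normalization\<close>

abbreviation negs :: "env \<Rightarrow> bool" where
  "negs \<Gamma> \<equiv> \<forall>p\<in>#\<Gamma>. neg (snd p)"

lemma in_at_iff [simp]: "\<sigma> \<in># at i \<Gamma> \<longleftrightarrow> (i, \<sigma>) \<in># \<Gamma>"
  by (induction \<Gamma> rule: env_induct) auto

lemma in_down_iff [simp]: "(i, \<sigma>) \<in># down k \<Gamma> \<longleftrightarrow> (i + k, \<sigma>) \<in># \<Gamma>"
  by (induction \<Gamma> rule: env_induct) auto

lemma negs_down: "negs \<Gamma> \<Longrightarrow> negs (down k \<Gamma>)"
  by (auto simp: down_def)

inductive_cases beta_VarE: "beta (Var x) N"
inductive_cases beta_LamE: "beta (Lam M) N"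
inductive_cases beta_AppE: "beta (App M M') N"
inductive_cases weak_head_AppE: "weak_head (App M M') N"

lemma beta_normal_simps [simp]:
  "beta_normal (Var x)"
  "beta_normal (Lam M) \<longleftrightarrow> beta_normal M"
  "beta_normal (App M N) \<longleftrightarrow> beta_normal M \<and> beta_normal N \<and> (\<forall>M'. M \<noteq> Lam M')"
  unfolding beta_normal_def
  by (blast elim: beta_VarE, blast elim: beta_LamE intro: beta.intros,
      blast elim: beta_AppE intro: beta.intros)

text \<open>The second claim strengthens the induction: a normal term that is not an abstraction can
  be given any \<open>neg\<close> type, so the function part of an application accepts whatever
  \<open>pos\<close> type its argument happens to have.\<close>

lemma beta_normal_typable:
  "beta_normal M \<Longrightarrow> (\<exists>\<tau> \<Gamma>. typable M \<tau> \<Gamma> \<and> pos \<tau> \<and> negs \<Gamma>) \<and>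
    ((\<forall>M'. M \<noteq> Lam M') \<longrightarrow> (\<forall>\<tau>. neg \<tau> \<longrightarrow> (\<exists>\<Gamma>. typable M \<tau> \<Gamma> \<and> negs \<Gamma>)))"
proof (induction M)
  case (Var x)
  show ?case by (auto intro: pos_star neg_star)
next
  case (App M N)
  have M: "\<exists>\<Gamma>. typable M \<tau> \<Gamma> \<and> negs \<Gamma>" if "neg \<tau>" for \<tau>
    using App.IH(1) App.prems that by (simp only: beta_normal_simps) blast
  from App obtain \<sigma> \<Delta> where N: "typable N \<sigma> \<Delta>" "pos \<sigma>" "negs \<Delta>" by auto
  have "\<exists>\<Gamma>. typable (App M N) \<tau> \<Gamma> \<and> negs \<Gamma>" if "neg \<tau>" for \<tau>
  proof -
    \<comment> \<open>One copy of the argument type makes the multiset nonempty, as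
      \<open>neg\<close> demands.\<close>
    have "neg (arr {#\<sigma>#} \<tau>)" using that N by simp
    then obtain \<Gamma> where "typable M (arr {#\<sigma>#} \<tau>) \<Gamma>" "negs \<Gamma>" using M by blast
    then show ?thesis
      using N unfolding typable_App
      by (intro exI[of _ "\<Gamma> + \<Delta>"] conjI exI[of _ "{#\<sigma>#}"] exI[of _ \<Gamma>] exI[of _ \<Delta>]) auto
  qed
  then show ?case using pos_star neg_star by blast
next
  case (Lam M)
  then obtain \<tau> \<Gamma> where "typable M \<tau> \<Gamma>" "pos \<tau>" "negs \<Gamma>" by auto
  then have "typable (Lam M) (arr (at 0 \<Gamma>) \<tau>) (down 1 \<Gamma>)" "pos (arr (at 0 \<Gamma>) \<tau>)" "negs (down 1 \<Gamma>)"
    using negs_down[of \<Gamma> 1] unfolding typable_Lam by (blast, force, simp)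
  then show ?case by blast
qed

lemma tm_head_cases:
  "(\<exists>x Ms. M = foldl App (Var x) Ms) \<or> (\<exists>M'. M = Lam M') \<or> (\<exists>M'. weak_head M M')"
proof (induction M)
  case (Var x)
  show ?case by (metis foldl_Nil)
next
  case (App M N)
  then consider x Ms where "M = foldl App (Var x) Ms" | M' where "M = Lam M'"
    | M' where "weak_head M M'"
    by blast
  then show ?case
  proof cases
    case 1
    then have "App M N = foldl App (Var x) (Ms @ [N])" by simp
    then show ?thesis by blast
  qed (auto intro: weak_head.intros)
qed auto

lemma weak_head_beta: "weak_head M N \<Longrightarrow> beta M N"
  by (induction rule: weak_head.induct) (auto intro: beta.intros)

lemma head_red_beta: "head_red M N \<Longrightarrow> beta M N"
  by (induction rule: head_red.induct) (auto intro: beta.intros weak_head_beta)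

lemma betas_App:
  assumes "beta\<^sup>*\<^sup>* M M'" "beta\<^sup>*\<^sup>* N N'"
  shows "beta\<^sup>*\<^sup>* (App M N) (App M' N')"
proof -
  have "beta\<^sup>*\<^sup>* (App M N) (App M' N)"
    using assms(1) by (induction rule: rtranclp_induct)
      (auto intro: beta.intros rtranclp.rtrancl_into_rtrancl)
  also have "beta\<^sup>*\<^sup>* (App M' N) (App M' N')"
    using assms(2) by (induction rule: rtranclp_induct)
      (auto intro: beta.intros rtranclp.rtrancl_into_rtrancl)
  finally show ?thesis .
qed

lemma betas_Lam: "beta\<^sup>*\<^sup>* M M' \<Longrightarrow> beta\<^sup>*\<^sup>* (Lam M) (Lam M')"
  by (induction rule: rtranclp_induct) (auto intro: beta.intros rtranclp.rtrancl_into_rtrancl)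

lemma has_beta_nf_Lam: "has_beta_nf M \<Longrightarrow> has_beta_nf (Lam M)"
  unfolding has_beta_nf_def using betas_Lam by fastforce

lemma has_beta_nf_foldl:
  assumes "\<And>M. M \<in> set Ms \<Longrightarrow> has_beta_nf M"
  shows "has_beta_nf (foldl App (Var x) Ms)"
proof -
  have "\<exists>N. beta\<^sup>*\<^sup>* (foldl App (Var x) Ms) N \<and> beta_normal N \<and> (\<forall>N'. N \<noteq> Lam N')"
    using assms
  proof (induction Ms rule: rev_induct)
    case Nil
    show ?case by (intro exI[of _ "Var x"]) simp
  next
    case (snoc M Ms)
    then obtain N where "beta\<^sup>*\<^sup>* (foldl App (Var x) Ms) N" "beta_normal N" "\<forall>N'. N \<noteq> Lam N'"
      by auto
    moreover obtain M' where "beta\<^sup>*\<^sup>* M M'" "beta_normal M'"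
      using snoc.prems[of M] by (auto simp: has_beta_nf_def)
    ultimately show ?case
      by (intro exI[of _ "App N M'"]) (auto intro: betas_App)
  qed
  then show ?thesis by (auto simp: has_beta_nf_def)
qed

lemma collect_memberD:
  assumes "collect P c A" "a \<in># A"
  obtains d e where "c = d + e" "P a d"
  using assms by (metis collect_add_mset insert_DiffM)

text \<open>Induction on the size covers both descents: a weak head step decreases it, and the type
  of a head variable is \<open>neg\<close>, so that no argument is left untyped and each has a
  smaller derivation at a \<open>pos\<close> type.\<close>

lemma ty_normalizes: "ty M \<tau> (n, \<Gamma>) \<Longrightarrow> pos \<tau> \<Longrightarrow> negs \<Gamma> \<Longrightarrow> has_beta_nf M"
proof (induction n arbitrary: M \<tau> \<Gamma> rule: less_induct)
  case (less n)
  consider x Ms where "M = foldl App (Var x) Ms" | M' where "M = Lam M'"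
    | M' where "weak_head M M'"
    using tm_head_cases by blast
  then show ?case
  proof cases
    case 1
    then obtain \<mu>s v ws where *: "length \<mu>s = length Ms"
      "(n, \<Gamma>) = v + (length Ms, 0) + (\<Sum>j<length Ms. ws j)" "v = (0, {#(x, arrs \<mu>s \<tau>)#})"
      "\<And>j. j < length Ms \<Longrightarrow> collect (ty (Ms ! j)) (ws j) (\<mu>s ! j)"
      using less.prems(1) unfolding \<open>M = _\<close> ty_foldl ty.simps by blast
    have size: "n = length Ms + (\<Sum>j<length Ms. fst (ws j))"
      using arg_cong[OF *(2), of fst] *(3) by (simp add: fst_sum)
    have env: "\<Gamma> = {#(x, arrs \<mu>s \<tau>)#} + (\<Sum>j<length Ms. snd (ws j))"
      using arg_cong[OF *(2), of snd] *(3) by (simp add: snd_sum)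
    have neg: "neg (arrs \<mu>s \<tau>)" using env less.prems(3) by simp
    have "has_beta_nf N" if N: "N \<in> set Ms" for N
    proof -
      obtain j where j: "j < length Ms" "N = Ms ! j" using N by (metis in_set_conv_nth)
      then have "\<mu>s ! j \<in> set \<mu>s" using *(1) by simp
      then have mu: "\<mu>s ! j \<noteq> {#}" "\<forall>\<sigma>\<in>#\<mu>s ! j. pos \<sigma>" using neg by (auto simp: neg_arrs)
      then obtain \<sigma> where \<sigma>: "\<sigma> \<in># \<mu>s ! j" by blast
      then obtain m \<Delta> e where d: "ws j = (m, \<Delta>) + e" "ty N \<sigma> (m, \<Delta>)"
        using *(4)[OF j(1)] j(2) by (metis collect_memberD surj_pair)
      have "fst (ws j) \<le> (\<Sum>j<length Ms. fst (ws j))"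
        using j by (intro member_le_sum) auto
      \<comment> \<open>Strictness comes from the summand \<open>length Ms\<close> in
        \<open>size\<close>, which is positive because there is an argument.\<close>
      then have "m < n" using size d(1) j by simp
      moreover have "snd (ws j) \<subseteq># (\<Sum>j<length Ms. snd (ws j))"
        using j by (simp add: sum.remove)
      then have "\<Delta> \<subseteq># \<Gamma>"
        using d(1) env by (simp add: subset_mset.add_increasing)
          (metis mset_subset_eq_add_left subset_mset.trans mset_subset_eq_add_right
            add_mset_add_single)
      ultimately show ?thesis
        using less.IH d(2) \<sigma> mu(2) less.prems(3) by (meson mset_subset_eqD)
    qed
    then show ?thesis using 1 has_beta_nf_foldl by blast
  next
    case 2
    then obtain m \<Delta> \<sigma> where "n = Suc m" "\<Gamma> = down 1 \<Delta>" "\<tau> = arr (at 0 \<Delta>) \<sigma>" "ty M' \<sigma> (m, \<Delta>)"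
      using less.prems(1) by auto
    moreover have "negs \<Delta>"
    proof
      fix p assume p: "p \<in># \<Delta>"
      show "neg (snd p)"
      proof (cases "fst p")
        case 0
        then have "snd p \<in># at 0 \<Delta>" using p by (metis in_at_iff prod.collapse)
        then show ?thesis using less.prems(2) \<open>\<tau> = _\<close> by auto
      next
        case (Suc i)
        then have "(fst p - 1, snd p) \<in># down 1 \<Delta>" using p by (cases p) simp
        then show ?thesis using less.prems(3) \<open>\<Gamma> = _\<close> by (metis snd_conv)
      qed
    qed
    ultimately show ?thesis
      using less.IH[of m M' \<sigma> \<Delta>] less.prems(2) 2 has_beta_nf_Lam by simp
  next
    case 3
    then obtain m where "m < n" "ty M' \<tau> (m, \<Gamma>)" using ty_weak_head less.prems(1) by blast
    then have "has_beta_nf M'" using less by blast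
    then show ?thesis
      using weak_head_beta[OF 3] unfolding has_beta_nf_def by (meson converse_rtranclp_into_rtranclp)
  qed
qed

lemma has_beta_nf_iff: "has_beta_nf M \<longleftrightarrow> (\<exists>\<tau> \<Gamma>. typable M \<tau> \<Gamma> \<and> pos \<tau> \<and> negs \<Gamma>)"
proof
  assume "has_beta_nf M"
  then obtain N where "beta\<^sup>*\<^sup>* M N" "beta_normal N" by (auto simp: has_beta_nf_def)
  then show "\<exists>\<tau> \<Gamma>. typable M \<tau> \<Gamma> \<and> pos \<tau> \<and> negs \<Gamma>"
    using beta_normal_typable[of N] typable_betas[of M N] by simp
qed (auto simp: typable_def intro: ty_normalizes)

lemma Hplus_if_typable_eq:
  assumes "typable M = typable N"
  shows "Hplus M N"
  unfolding Hplus_def has_beta_nf_iff typable_fill_cong[OF assms] by blast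

section \<open>Head normal forms\<close>

lemma foldl_App_neq_Lam [simp]:
  "foldl App (Var y) Ms \<noteq> Lam M" "Lam M \<noteq> foldl App (Var y) Ms"
  by (induction Ms rule: rev_induct) auto

lemma foldl_App_inject:
  "foldl App (Var y) Ms = foldl App (Var z) Ns \<Longrightarrow> y = z \<and> Ms = Ns"
proof (induction Ms arbitrary: Ns rule: rev_induct)
  case Nil
  then show ?case by (cases Ns rule: rev_cases) auto
next
  case (snoc M Ms)
  then show ?case by (cases Ns rule: rev_cases) auto
qed

lemma hnf_inject: "hnf n y Ms = hnf m z Ns \<Longrightarrow> n = m \<and> y = z \<and> Ms = Ns"
proof (induction n arbitrary: m)
  case 0
  then show ?case
    using foldl_App_inject by (cases m) (auto simp: hnf_def)
next
  case (Suc n)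
  then show ?case
    by (cases m) (auto simp: hnf_def)
qed

lemma weak_head_foldl: "\<not> weak_head (foldl App (Var y) Ms) N"
proof (induction Ms arbitrary: N rule: rev_induct)
  case Nil
  show ?case by (auto elim: weak_head.cases)
next
  case (snoc M Ms)
  then show ?case
    by (auto elim: weak_head_AppE)
qed

inductive_cases weak_head_LamE: "weak_head (Lam M) N"

lemma head_red_hnf: "\<not> head_red (hnf n y Ms) N"
proof (induction n arbitrary: N)
  case 0
  show ?case
  proof
    assume "head_red (hnf 0 y Ms) N"
    then show False by cases (simp_all add: hnf_def weak_head_foldl)
  qed
next
  case (Suc n)
  show ?case
  proof
    assume "head_red (hnf (Suc n) y Ms) N"
    then show False
      by cases (use Suc in \<open>auto simp: hnf_def elim: weak_head_LamE\<close>)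
  qed
qed

lemma weak_head_det: "weak_head M N \<Longrightarrow> weak_head M N' \<Longrightarrow> N = N'"
proof (induction arbitrary: N' rule: weak_head.induct)
  case (1 M N)
  then show ?case by (auto elim: weak_head.cases)
next
  case (2 M M' N)
  from 2(3) show ?case
  proof cases
    case (1 s)
    then show ?thesis using 2(1) by (auto elim: weak_head.cases)
  next
    case (2 s')
    then show ?thesis using \<open>\<And>N'. weak_head M N' \<Longrightarrow> M' = N'\<close> by auto
  qed
qed

lemma head_red_det: "head_red M N \<Longrightarrow> head_red M N' \<Longrightarrow> N = N'"
proof (induction arbitrary: N' rule: head_red.induct)
  case (1 M N)
  from 1(2) show ?case
    using weak_head_det 1(1) by cases (auto elim: weak_head.cases)
next
  case (2 M M')
  from 2(3) show ?case
  proof cases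
    case 1
    then show ?thesis by (auto elim: weak_head.cases)
  next
    case (2 s')
    then show ?thesis using \<open>\<And>N'. head_red M N' \<Longrightarrow> M' = N'\<close> by auto
  qed
qed

lemma head_reds_hnf_unique:
  assumes "head_red\<^sup>*\<^sup>* M (hnf n y Ms)" "head_red\<^sup>*\<^sup>* M (hnf m z Ns)"
  shows "n = m \<and> y = z \<and> Ms = Ns"
proof -
  have "hnf n y Ms = hnf m z Ns"
    using assms
  proof (induction rule: converse_rtranclp_induct)
    case base
    then show ?case using head_red_hnf by (auto elim: converse_rtranclpE)
  next
    case (step M M')
    from step(4) have "head_red\<^sup>*\<^sup>* M' (hnf m z Ns)"
    proof (cases rule: converse_rtranclpE)
      case base
      then show ?thesis using step(1) head_red_hnf by blast
    next
      case (step M'')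
      then show ?thesis using \<open>head_red M M'\<close> head_red_det by blast
    qed
    then show ?case by (rule step(3))
  qed
  then show ?thesis by (rule hnf_inject)
qed

lemma phnf_eq: "phnf M = Some (n, y, Ms) \<longleftrightarrow> head_red\<^sup>*\<^sup>* M (hnf n y Ms)"
proof -
  have the: "(THE (n, y, Ms). head_red\<^sup>*\<^sup>* M (hnf n y Ms)) = (n, y, Ms)"
    if "head_red\<^sup>*\<^sup>* M (hnf n y Ms)" for n y Ms
    using that by (intro the_equality) (auto dest: head_reds_hnf_unique)
  show ?thesis
  proof
    assume *: "phnf M = Some (n, y, Ms)"
    then obtain n' y' Ms' where "head_red\<^sup>*\<^sup>* M (hnf n' y' Ms')"
      by (auto simp: phnf_def split: if_splits)
    with * show "head_red\<^sup>*\<^sup>* M (hnf n y Ms)"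
      using the by (auto simp: phnf_def split: if_splits)
  next
    assume "head_red\<^sup>*\<^sup>* M (hnf n y Ms)"
    then show "phnf M = Some (n, y, Ms)"
      using the by (auto simp: phnf_def)
  qed
qed

lemma BT_eq_Hnf: "BT M = Hnf n y Ts \<longleftrightarrow> (\<exists>Ms. head_red\<^sup>*\<^sup>* M (hnf n y Ms) \<and> Ts = map BT Ms)"
  by (subst BT.code) (auto simp: phnf_eq[symmetric] split: option.splits)

section \<open>Relational semantics of permutation trees\<close>

text \<open>Lets the inductive definition of \<open>tsem\<close> recurse under
  \<open>rel_mset\<close>.\<close>

lemma rel_mset_mono [mono]: "R \<le> S \<Longrightarrow> rel_mset R \<le> rel_mset S"
  by (rule multiset.rel_mono)

text \<open>The intended meaning is that the tree, applied to a variable of type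
  \<open>\<sigma>\<close>, has type \<open>\<tau>\<close>. The head receives as argument number
  \<open>Suc i\<close> child \<open>i\<close> applied to bound variable number
  \<open>\<pi> (Suc i)\<close>, which explains the index into \<open>\<nu>s\<close>. The least fixed
  point is taken because derivations are finite.\<close>

inductive tsem :: "ptree \<Rightarrow> nat \<Rightarrow> nat \<Rightarrow> bool" where
  "length \<mu>s = length ts \<Longrightarrow> length \<nu>s = length ts \<Longrightarrow>
   (\<forall>i<length ts. rel_mset (tsem (ts ! i)) (\<nu>s ! (\<pi> (Suc i) - 1)) (\<mu>s ! i)) \<Longrightarrow>
   tsem (Node \<pi> ts) (arrs \<mu>s \<tau>) (arrs \<nu>s \<tau>)"

lemma permutes_pred:
  assumes "\<pi> permutes {1..k}" "i < k"
  shows "\<pi> (Suc i) - 1 < k" "Suc (\<pi> (Suc i) - 1) = \<pi> (Suc i)"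
  using permutes_le[OF assms(1), of "Suc i"] assms(2) by auto

lemma at_sum: "at i (\<Sum>j\<in>A. \<Gamma> j) = (\<Sum>j\<in>A. at i (\<Gamma> j))"
  by (induction A rule: infinite_finite_induct) auto

lemma down_sum: "down k (\<Sum>j\<in>A. \<Gamma> j) = (\<Sum>j\<in>A. down k (\<Gamma> j))"
  by (induction A rule: infinite_finite_induct) auto

text \<open>As \<open>\<pi>\<close> is a permutation, every bound variable is passed to exactly one
  child; its types therefore come from a single summand.\<close>

lemma hnf_env:
  assumes \<pi>: "\<pi> permutes {1..k}" and len: "length \<nu>s = k"
    and \<Gamma>: "\<Gamma> = {#(x + k, \<sigma>)#} + (\<Sum>j<k. image_mset (Pair (k - \<pi> (Suc j))) (\<nu>s ! (\<pi> (Suc j) - 1)))"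
  shows "down k \<Gamma> = {#(x, \<sigma>)#}" "map (\<lambda>i. at (k - 1 - i) \<Gamma>) [0..<k] = \<nu>s"
proof -
  have "down k (image_mset (Pair (k - \<pi> (Suc j))) \<mu>) = {#}" if "j < k" for j \<mu>
    using permutes_le[OF \<pi>, of "Suc j"] that by auto
  then show "down k \<Gamma> = {#(x, \<sigma>)#}"
    by (simp add: \<Gamma> down_sum)
  show "map (\<lambda>i. at (k - 1 - i) \<Gamma>) [0..<k] = \<nu>s"
  proof (rule nth_equalityI)
    fix i assume "i < length (map (\<lambda>i. at (k - 1 - i) \<Gamma>) [0..<k])"
    then have i: "i < k" by simp
    \<comment> \<open>The child to which the binder at position \<open>i\<close> is passed.\<close>
    define j0 where "j0 = inv \<pi> (Suc i) - 1"
    have "inv \<pi> (Suc i) \<in> {1..k}"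
      using permutes_in_image[OF permutes_inv[OF \<pi>], of "Suc i"] i by simp
    then have j0: "j0 < k" "Suc j0 = inv \<pi> (Suc i)"
      by (auto simp: j0_def)
    then have \<pi>j0: "\<pi> (Suc j0) = Suc i"
      using permutes_inverses(1)[OF \<pi>] by simp
    have eq: "k - 1 - i = k - \<pi> (Suc j) \<longleftrightarrow> j = j0" if "j < k" for j
    proof
      assume "k - 1 - i = k - \<pi> (Suc j)"
      then have "\<pi> (Suc j) = Suc i" using i permutes_le[OF \<pi>, of "Suc j"] that by auto
      then have "\<pi> (Suc j) = \<pi> (Suc j0)" using \<pi>j0 by simp
      then show "j = j0" using permutes_inj[OF \<pi>] by (metis injD nat.inject)
    qed (use \<pi>j0 i in auto)
    have "at (k - 1 - i) \<Gamma> = (\<Sum>j<k. if j = j0 then \<nu>s ! (\<pi> (Suc j) - 1) else {#})"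
      using i eq by (auto simp: \<Gamma> at_sum intro!: sum.cong)
    also have "\<dots> = \<nu>s ! i"
      using j0 \<pi>j0 by (simp add: sum.delta)
    finally show "map (\<lambda>i. at (k - 1 - i) \<Gamma>) [0..<k] ! i = \<nu>s ! i"
      using i by simp
  qed (simp add: len)
qed

text \<open>When each derivation uses a single entry, for \<open>x\<close>, the summed environment
  is a multiset of input types matched with \<open>\<mu>\<close>. The second assumption is limited
  to sizes up to \<open>n\<close> so that an induction hypothesis on size can discharge it.\<close>

lemma collect_linear:
  fixes n :: nat
  assumes "collect P (n, \<Gamma>) \<mu>"
    and "\<And>\<sigma> m \<Delta>. m \<le> n \<Longrightarrow> P \<sigma> (m, \<Delta>) \<Longrightarrow> \<exists>\<rho>. \<Delta> = {#(x, \<rho>)#} \<and> R \<rho> \<sigma>"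
  shows "\<exists>\<nu>. \<Gamma> = image_mset (Pair x) \<nu> \<and> rel_mset R \<nu> \<mu>"
  using assms
proof (induction \<mu> arbitrary: n \<Gamma> rule: multiset_induct)
  case empty
  then show ?case by (auto simp: zero_prod_def)
next
  case (add \<sigma> \<mu>)
  then obtain n1 \<Gamma>1 n2 \<Gamma>2 where *: "n = n1 + n2" "\<Gamma> = \<Gamma>1 + \<Gamma>2" "P \<sigma> (n1, \<Gamma>1)"
    "collect P (n2, \<Gamma>2) \<mu>"
    by (auto simp: collect_add_mset)
  from add.prems(2)[OF _ *(3)] *(1) obtain \<rho> where "\<Gamma>1 = {#(x, \<rho>)#}" "R \<rho> \<sigma>" by auto
  moreover have "\<exists>\<nu>. \<Gamma>2 = image_mset (Pair x) \<nu> \<and> rel_mset R \<nu> \<mu>"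
    using add.IH[OF *(4)] add.prems(2) *(1) by (meson le_add2 order_trans)
  then obtain \<nu> where "\<Gamma>2 = image_mset (Pair x) \<nu>" "rel_mset R \<nu> \<mu>" by blast
  ultimately show ?case
    using *(2) by (intro exI[of _ "add_mset \<rho> \<nu>"]) (simp add: rel_mset_Plus)
qed

lemma collect_linearI:
  assumes "rel_mset R \<nu> \<mu>" "\<And>\<rho> \<sigma>. R \<rho> \<sigma> \<Longrightarrow> P \<sigma> {#(x, \<rho>)#}"
  shows "collect P (image_mset (Pair x) \<nu>) \<mu>"
  using assms
proof (induction rule: rel_mset_induct)
  case (add R \<rho> \<sigma> \<nu> \<mu>)
  then show ?case
    using collect_add[of P \<sigma> "{#(x, \<rho>)#}" "image_mset (Pair x) \<nu>" \<mu>] by simp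
qed simp

lemma BT_eq_ptree_at:
  assumes "BT M = ptree_at x t"
  obtains Ms where "head_red\<^sup>*\<^sup>* M (hnf (length (children t)) (x + length (children t)) Ms)"
    "length Ms = length (children t)"
    "\<And>i. i < length (children t) \<Longrightarrow>
      BT (Ms ! i) = ptree_at (length (children t) - label t (Suc i)) (children t ! i)"
proof -
  let ?k = "length (children t)"
  have "BT M = Hnf ?k (x + ?k) (map (\<lambda>i. ptree_at (?k - label t i) (children t ! (i - 1))) [1..<Suc ?k])"
    using assms by (subst (asm) ptree_at.code)
  then obtain Ms where Ms: "head_red\<^sup>*\<^sup>* M (hnf ?k (x + ?k) Ms)"
    "map BT Ms = map (\<lambda>i. ptree_at (?k - label t i) (children t ! (i - 1))) [1..<Suc ?k]"
    unfolding BT_eq_Hnf by metis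
  from arg_cong[OF Ms(2), of length] have len: "length Ms = ?k" by (simp del: upt_Suc)
  moreover have "BT (Ms ! i) = ptree_at (?k - label t (Suc i)) (children t ! i)" if "i < ?k" for i
    using arg_cong[OF Ms(2), of "\<lambda>Ts. Ts ! i"] that len by (simp del: upt_Suc)
  ultimately show ?thesis using that Ms(1) by blast
qed

lemma head_reds_betas: "head_red\<^sup>*\<^sup>* M N \<Longrightarrow> beta\<^sup>*\<^sup>* M N"
  by (induction rule: rtranclp_induct) (auto dest: head_red_beta)

text \<open>Induction on derivation size stands in for induction on the tree: head reduction does
  not increase it, and the typed arguments of the head normal form have strictly smaller
  derivations.\<close>

lemma ty_BT:
  "ty M \<tau> (n, \<Gamma>) \<Longrightarrow> t \<in> PT \<Longrightarrow> BT M = ptree_at x t \<Longrightarrow> \<exists>\<sigma>. \<Gamma> = {#(x, \<sigma>)#} \<and> tsem t \<sigma> \<tau>"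
proof (induction n arbitrary: M \<tau> \<Gamma> t x rule: less_induct)
  case (less n)
  define k where "k = length (children t)"
  define \<pi> where "\<pi> = label t"
  have \<pi>: "\<pi> permutes {1..k}" using PT_D(1)[OF less.prems(2)] by (simp add: k_def \<pi>_def)
  obtain Ms where Ms: "head_red\<^sup>*\<^sup>* M (hnf k (x + k) Ms)" "length Ms = k"
    "\<And>i. i < k \<Longrightarrow> BT (Ms ! i) = ptree_at (k - \<pi> (Suc i)) (children t ! i)"
    using BT_eq_ptree_at[OF less.prems(3)] unfolding k_def \<pi>_def by metis
  obtain m where m: "m \<le> n" "ty (hnf k (x + k) Ms) \<tau> (m, \<Gamma>)"
    using ty_betas[OF head_reds_betas[OF Ms(1)] less.prems(1)] by blast
  then obtain m' \<Gamma>' \<rho> where m': "m = m' + k" "\<Gamma> = down k \<Gamma>'"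
    "\<tau> = arrs (map (\<lambda>j. at (k - 1 - j) \<Gamma>') [0..<k]) \<rho>" "ty (foldl App (Var (x + k)) Ms) \<rho> (m', \<Gamma>')"
    unfolding hnf_def ty_lams by blast
  then obtain \<mu>s v ws where *: "length \<mu>s = k"
    "(m', \<Gamma>') = v + (k, 0) + (\<Sum>j<k. ws j)" "v = (0, {#(x + k, arrs \<mu>s \<rho>)#})"
    "\<And>j. j < k \<Longrightarrow> collect (ty (Ms ! j)) (ws j) (\<mu>s ! j)"
    unfolding ty_foldl ty.simps Ms(2) by blast
  have size: "m' = k + (\<Sum>j<k. fst (ws j))"
    using arg_cong[OF *(2), of fst] *(3) by (simp add: fst_sum)
  have env: "\<Gamma>' = {#(x + k, arrs \<mu>s \<rho>)#} + (\<Sum>j<k. snd (ws j))"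
    using arg_cong[OF *(2), of snd] *(3) by (simp add: snd_sum)
  have "\<exists>\<nu>. snd (ws j) = image_mset (Pair (k - \<pi> (Suc j))) \<nu> \<and>
      rel_mset (tsem (children t ! j)) \<nu> (\<mu>s ! j)"
    if j: "j < k" for j
  proof (rule collect_linear)
    show "collect (ty (Ms ! j)) (fst (ws j), snd (ws j)) (\<mu>s ! j)" using *(4)[OF j] by simp
    fix \<sigma> l \<Delta> assume l: "l \<le> fst (ws j)" "ty (Ms ! j) \<sigma> (l, \<Delta>)"
    have "fst (ws j) \<le> (\<Sum>j<k. fst (ws j))"
      using j by (intro member_le_sum) auto
    then have "l < n" using l m m' size j by simp
    then show "\<exists>\<rho>. \<Delta> = {#(k - \<pi> (Suc j), \<rho>)#} \<and> tsem (children t ! j) \<rho> \<sigma>"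
      using less.IH l(2) PT_D(2)[OF less.prems(2)] Ms(3)[OF j] j by (simp add: k_def)
  qed
  then obtain \<nu> where \<nu>: "\<And>j. j < k \<Longrightarrow> snd (ws j) = image_mset (Pair (k - \<pi> (Suc j))) (\<nu> j)"
    "\<And>j. j < k \<Longrightarrow> rel_mset (tsem (children t ! j)) (\<nu> j) (\<mu>s ! j)"
    by metis
  \<comment> \<open>\<open>\<nu>\<close> is indexed by arguments, \<open>\<nu>s\<close> by binders;
    the inverse of the label translates.\<close>
  define \<nu>s where "\<nu>s = map (\<lambda>i. \<nu> (inv \<pi> (Suc i) - 1)) [0..<k]"
  have \<nu>s: "\<nu>s ! (\<pi> (Suc j) - 1) = \<nu> j" if "j < k" for j
    using permutes_pred[OF \<pi> that] permutes_inverses(2)[OF \<pi>] by (simp add: \<nu>s_def)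
  have env': "\<Gamma>' = {#(x + k, arrs \<mu>s \<rho>)#} +
      (\<Sum>j<k. image_mset (Pair (k - \<pi> (Suc j))) (\<nu>s ! (\<pi> (Suc j) - 1)))"
    unfolding env using \<nu>(1) \<nu>s by (auto intro!: sum.cong)
  have "length \<nu>s = k" by (simp add: \<nu>s_def)
  note hnf_env[OF \<pi> this env']
  moreover have "tsem (Node \<pi> (children t)) (arrs \<mu>s \<rho>) (arrs \<nu>s \<rho>)"
    using \<nu>(2) \<nu>s *(1) by (intro tsem.intros) (auto simp: k_def \<nu>s_def)
  ultimately show ?case
    using m'(2,3) by (intro exI[of _ "arrs \<mu>s \<rho>"]) (simp add: \<pi>_def)
qed

text \<open>A derivation of \<open>tsem\<close> is well-founded even if the tree is not. The typing
  built for the head normal form is carried back to \<open>M\<close> by invariance under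
  beta.\<close>

lemma tsem_typable:
  "tsem t \<sigma> \<tau> \<Longrightarrow> t \<in> PT \<Longrightarrow> BT M = ptree_at x t \<Longrightarrow> typable M \<tau> {#(x, \<sigma>)#}"
proof (induction arbitrary: M x rule: tsem.induct)
  case (1 \<mu>s ts \<nu>s \<pi> \<tau>)
  define k where "k = length ts"
  have \<pi>: "\<pi> permutes {1..k}" using PT_D(1)[OF 1(4)] by (simp add: k_def)
  obtain Ms where Ms: "head_red\<^sup>*\<^sup>* M (hnf k (x + k) Ms)" "length Ms = k"
    "\<And>i. i < k \<Longrightarrow> BT (Ms ! i) = ptree_at (k - \<pi> (Suc i)) (ts ! i)"
    using BT_eq_ptree_at[OF 1(5)] unfolding k_def by (metis tree.sel)
  let ?\<Delta> = "\<lambda>j. image_mset (Pair (k - \<pi> (Suc j))) (\<nu>s ! (\<pi> (Suc j) - 1))"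
  let ?\<Gamma> = "{#(x + k, arrs \<mu>s \<tau>)#} + (\<Sum>j<k. ?\<Delta> j)"
  have "collect (typable (Ms ! j)) (?\<Delta> j) (\<mu>s ! j)" if j: "j < k" for j
  proof -
    have "rel_mset (\<lambda>\<rho> \<sigma>. typable (Ms ! j) \<sigma> {#(k - \<pi> (Suc j), \<rho>)#}) (\<nu>s ! (\<pi> (Suc j) - 1)) (\<mu>s ! j)"
      by (rule multiset.rel_mono_strong[OF 1(3)[rule_format, of j]])
        (use j Ms(3) PT_D(2)[OF 1(4)] in \<open>auto simp: k_def\<close>)
    then show ?thesis
      by (rule collect_linearI) simp
  qed
  then have "typable (foldl App (Var (x + k)) Ms) \<tau> ?\<Gamma>"
    unfolding typable_foldl Ms(2) using 1(1)
    by (intro exI[of _ \<mu>s] exI[of _ "{#(x + k, arrs \<mu>s \<tau>)#}"] exI[of _ ?\<Delta>]) (simp add: k_def)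
  then have "typable (hnf k (x + k) Ms) (arrs (map (\<lambda>j. at (k - 1 - j) ?\<Gamma>) [0..<k]) \<tau>) (down k ?\<Gamma>)"
    unfolding hnf_def typable_lams by (intro exI conjI) (rule refl)+
  then have "typable (hnf k (x + k) Ms) (arrs \<nu>s \<tau>) {#(x, arrs \<mu>s \<tau>)#}"
    unfolding hnf_env[OF \<pi> 1(2)[folded k_def] refl] .
  then show ?case
    using typable_betas[OF head_reds_betas[OF Ms(1)]] by simp
qed

lemma typable_BT:
  assumes "t \<in> PT" "BT M = ptree_at x t"
  shows "typable M \<tau> \<Gamma> \<longleftrightarrow> (\<exists>\<sigma>. \<Gamma> = {#(x, \<sigma>)#} \<and> tsem t \<sigma> \<tau>)"
  using assms ty_BT tsem_typable unfolding typable_def by blast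

text \<open>Ties a term to a tree by typings alone, a relation that child extraction preserves. The
  empty environment makes variable capture by contexts harmless.\<close>

definition sem_HP :: "ptree \<Rightarrow> tm \<Rightarrow> bool" where
  "sem_HP t M \<longleftrightarrow> (\<forall>\<tau> \<Gamma>. typable M \<tau> \<Gamma> \<longleftrightarrow> \<Gamma> = {#} \<and> (\<exists>\<sigma> \<rho>. \<tau> = arr {#\<sigma>#} \<rho> \<and> tsem t \<sigma> \<rho>))"

lemma sem_HP_if_BT:
  assumes "t \<in> PT" "BT M = ptree_bt t"
  shows "sem_HP t M"
proof -
  obtain n z Ts where T: "ptree_at 0 t = Hnf n z Ts" by (metis ptree_at.code)
  then have "BT M = Hnf (Suc n) z Ts" using assms(2) by (simp add: ptree_bt_def)
  then obtain Ms where Ms: "head_red\<^sup>*\<^sup>* M (hnf (Suc n) z Ms)" "Ts = map BT Ms"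
    unfolding BT_eq_Hnf by blast
  have "BT (hnf n z Ms) = ptree_at 0 t"
    unfolding T BT_eq_Hnf using Ms(2) by blast
  note hnf = typable_BT[OF assms(1) this]
  have "typable M = typable (Lam (hnf n z Ms))"
    using typable_betas[OF head_reds_betas[OF Ms(1)]] by (simp add: hnf_def)
  moreover have "typable (Lam (hnf n z Ms)) \<tau> \<Gamma> \<longleftrightarrow>
      (\<exists>\<sigma> \<rho>. \<Gamma> = down 1 {#(0, \<sigma>)#} \<and> \<tau> = arr (at 0 {#(0, \<sigma>)#}) \<rho> \<and> tsem t \<sigma> \<rho>)" for \<tau> \<Gamma>
    unfolding typable_Lam hnf by blast
  ultimately show ?thesis
    unfolding sem_HP_def by auto
qed

lemma tree_of_props:
  assumes "M \<in> HP"
  shows "tree_of M \<in> PT" "BT M = ptree_bt (tree_of M)"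
proof -
  have "inj_on ptree_bt PT" "BT M \<in> ptree_bt ` PT"
    using bij_betw_ptree_bt assms by (auto simp: HP_def bij_betw_def)
  then have "\<exists>!t. t \<in> PT \<and> ptree_bt t = BT M"
    unfolding inj_on_def image_iff by metis
  from theI'[OF this] show "tree_of M \<in> PT" "BT M = ptree_bt (tree_of M)"
    by (auto simp: tree_of_def)
qed

lemma Hplus_if_sem_HP: "sem_HP t M \<Longrightarrow> sem_HP u N \<Longrightarrow> tsem t = tsem u \<Longrightarrow> Hplus M N"
  by (intro Hplus_if_typable_eq ext) (simp add: sem_HP_def)

section \<open>Similarity of permutation trees\<close>

text \<open>\<open>E'\<close> in inductive form: in a finitely branching tree, finiteness of the
  node set amounts to well-foundedness. The agreement is \<open>E'_eq\<close>.\<close>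

inductive fin_id :: "ptree \<Rightarrow> bool" where
  "(\<forall>t\<in>set ts. fin_id t) \<Longrightarrow> fin_id (Node id ts)"

lemma nodes_Node:
  "{w. node (Node \<pi> ts) w} = insert [] (\<Union>i\<in>{1..length ts}. (#) i ` {w. node (ts ! (i - 1)) w})"
proof (rule set_eqI)
  fix w
  show "w \<in> {w. node (Node \<pi> ts) w} \<longleftrightarrow>
      w \<in> insert [] (\<Union>i\<in>{1..length ts}. (#) i ` {w. node (ts ! (i - 1)) w})"
    by (cases w) auto
qed

lemma finite_nodes_Node:
  "finite {w. node (Node \<pi> ts) w} \<longleftrightarrow> (\<forall>t\<in>set ts. finite {w. node t w})"
proof -
  have "(\<forall>i\<in>{1..length ts}. P (ts ! (i - 1))) \<longleftrightarrow> (\<forall>t\<in>set ts. P t)" for P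
    unfolding all_set_conv_all_nth by (force dest: bspec[of _ _ "Suc _"])
  then show ?thesis
    unfolding nodes_Node by (simp add: finite_image_iff)
qed

lemma fin_id_E': "fin_id t \<Longrightarrow> t \<in> E'"
proof (induction rule: fin_id.induct)
  case (1 ts)
  then have "Node id ts \<in> PT"
    by (intro PT.intros) (auto simp: E'_def permutes_id)
  then show ?case
    using 1 by (fastforce simp: E'_def finite_nodes_Node)
qed

lemma E'_fin_id: "t \<in> E' \<Longrightarrow> fin_id t"
proof (induction "card {w. node t w}" arbitrary: t rule: less_induct)
  case less
  obtain \<pi> ts where t: "t = Node \<pi> ts" by (cases t)
  have fin: "finite {w. node t w}" using less.prems by (simp add: E'_def)
  have "fin_id s" if s: "s \<in> set ts" for s
  proof (rule less.hyps)
    show "s \<in> E'"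
      using less.prems s by (auto simp: t E'_def finite_nodes_Node elim: PT.cases)
    obtain i where i: "i < length ts" "s = ts ! i" using s by (metis in_set_conv_nth)
    \<comment> \<open>Prefixing with the index of the child embeds its nodes into those of
      \<open>t\<close> and misses the root, so the cardinality drops.\<close>
    have "(#) (Suc i) ` {w. node s w} \<subset> {w. node t w}"
      using i by (auto simp: t)
    then have "card ((#) (Suc i) ` {w. node s w}) < card {w. node t w}"
      using fin by (rule psubset_card_mono[rotated])
    then show "card {w. node s w} < card {w. node t w}"
      by (simp add: card_image)
  qed
  moreover have "\<pi> = id" using less.prems by (auto simp: t E'_def)
  ultimately show ?case by (auto simp: t intro: fin_id.intros)
qed

lemma E'_eq: "t \<in> E' \<longleftrightarrow> fin_id t"
  using E'_fin_id fin_id_E' by blast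

lemma fin_id_iff: "fin_id t \<longleftrightarrow> label t = id \<and> (\<forall>i<length (children t). fin_id (children t ! i))"
  by (cases t) (auto simp: fin_id.simps[of "Node _ _"] all_set_conv_all_nth)

text \<open>The local form of having a common expansion and of having the same minimal tree: it can
  be checked level by level, without constructing a third tree.\<close>

coinductive sim :: "ptree \<Rightarrow> ptree \<Rightarrow> bool" where
  "label t = label u \<Longrightarrow>
   (\<forall>i<min (length (children t)) (length (children u)). sim (children t ! i) (children u ! i)) \<Longrightarrow>
   (\<forall>i\<in>{length (children u)..<length (children t)}. fin_id (children t ! i)) \<Longrightarrow>
   (\<forall>i\<in>{length (children t)..<length (children u)}. fin_id (children u ! i)) \<Longrightarrow> sim t u"

lemma simD:
  assumes "sim t u"
  shows "label t = label u"
    "i < length (children t) \<Longrightarrow> i < length (children u) \<Longrightarrow> sim (children t ! i) (children u ! i)"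
    "i < length (children t) \<Longrightarrow> length (children u) \<le> i \<Longrightarrow> fin_id (children t ! i)"
    "i < length (children u) \<Longrightarrow> length (children t) \<le> i \<Longrightarrow> fin_id (children u ! i)"
  using assms by (auto elim: sim.cases)

lemma sim_sym: "sim t u \<Longrightarrow> sim u t"
proof (coinduction arbitrary: t u)
  case sim
  then show ?case by (auto dest: simD)
qed

lemma sim_fin_id: "fin_id u \<Longrightarrow> sim t u \<Longrightarrow> fin_id t"
proof (induction arbitrary: t rule: fin_id.induct)
  case (1 us)
  then have "fin_id (children t ! i)" if "i < length (children t)" for i
    using simD(2,3)[OF 1(2), of i] that by (cases "i < length us") auto
  then show ?case
    using simD(1)[OF 1(2)] by (subst fin_id_iff) simp
qed

section \<open>Similar trees have the same semantics\<close>

text \<open>The default leaf stands for the identity: eta-expansion appends bound variables as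
  further arguments, that is, leaves as further children.\<close>

definition child :: "ptree \<Rightarrow> nat \<Rightarrow> ptree" where
  "child t i = (if i < length (children t) then children t ! i else Node id [])"

lemma child_Leaf [simp]: "child (Node id []) i = Node id []"
  by (simp add: child_def)

lemma fin_id_Leaf [simp]: "fin_id (Node id [])"
  by (simp add: fin_id.intros)

lemma fin_id_PT: "fin_id t \<Longrightarrow> t \<in> PT"
  using fin_id_E' by (auto simp: E'_def)

lemma child_PT: "t \<in> PT \<Longrightarrow> child t i \<in> PT"
  by (auto simp: child_def PT_D(2) fin_id_PT)

lemma tsem_iff:
  assumes "length \<mu>s = length (children t)" "length \<nu>s = length (children t)"
  shows "tsem t (arrs \<mu>s \<sigma>) (arrs \<nu>s \<tau>) \<longleftrightarrow> \<sigma> = \<tau> \<and>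
    (\<forall>i<length (children t). rel_mset (tsem (children t ! i)) (\<nu>s ! (label t (Suc i) - 1)) (\<mu>s ! i))"
    (is "?l \<longleftrightarrow> ?r")
proof
  assume ?l
  then show ?r
    using assms by cases auto
next
  assume ?r
  then show ?l
    using assms tsem.intros[of \<mu>s "children t" \<nu>s "label t" \<tau>] by simp
qed

text \<open>Any type splits into as many arrows as the root has children; equality then holds
  componentwise by the induction hypothesis.\<close>

lemma tsem_fin_id: "fin_id t \<Longrightarrow> tsem t = (=)"
proof (induction rule: fin_id.induct)
  case (1 ts)
  show ?case
  proof (intro ext)
    fix \<sigma> \<tau>
    obtain \<mu>s \<sigma>' where \<sigma>: "length \<mu>s = length ts" "\<sigma> = arrs \<mu>s \<sigma>'" by (rule arrs_cases)
    obtain \<nu>s \<tau>' where \<tau>: "length \<nu>s = length ts" "\<tau> = arrs \<nu>s \<tau>'" by (rule arrs_cases)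
    have "tsem (Node id ts) \<sigma> \<tau> \<longleftrightarrow> \<sigma>' = \<tau>' \<and> (\<forall>i<length ts. \<nu>s ! i = \<mu>s ! i)"
      using \<sigma> \<tau> 1 by (simp add: tsem_iff multiset.rel_eq cong: conj_cong)
    also have "\<dots> \<longleftrightarrow> \<sigma> = \<tau>"
      using \<sigma> \<tau> by (auto simp: list_eq_iff_nth_eq)
    finally show "tsem (Node id ts) \<sigma> \<tau> = (\<sigma> = \<tau>)" .
  qed
qed

lemma tsem_Leaf [simp]: "tsem (Node id []) = (=)"
  by (simp add: tsem_fin_id)

text \<open>The label fixes positions past the children, and there the unsplit rest of the type is
  shared, which is the equality that a leaf imposes. Two trees can thus be read at a common
  width.\<close>

lemma tsem_pad:
  assumes "t \<in> PT" "length (children t) \<le> k" and len: "length \<mu>s = k" "length \<nu>s = k"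
  shows "tsem t (arrs \<mu>s \<sigma>) (arrs \<nu>s \<tau>) \<longleftrightarrow> \<sigma> = \<tau> \<and>
    (\<forall>i<k. rel_mset (tsem (child t i)) (\<nu>s ! (label t (Suc i) - 1)) (\<mu>s ! i))"
proof -
  let ?n = "length (children t)"
  have split: "arrs \<mu>s \<sigma> = arrs (take ?n \<mu>s) (arrs (drop ?n \<mu>s) \<sigma>)" for \<mu>s \<sigma>
    by (metis append_take_drop_id foldr_append)
  have fix_: "label t (Suc i) = Suc i" if "i \<ge> ?n" for i
    using permutes_not_in[OF PT_D(1)[OF assms(1)], of "Suc i"] that by simp
  have lt: "label t (Suc i) - 1 < ?n" if "i < ?n" for i
    using permutes_pred(1)[OF PT_D(1)[OF assms(1)] that] .
  have drop: "drop ?n \<mu>s = drop ?n \<nu>s \<longleftrightarrow> (\<forall>i\<in>{?n..<k}. \<nu>s ! i = \<mu>s ! i)"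
  proof -
    have "drop ?n \<mu>s = drop ?n \<nu>s \<longleftrightarrow> (\<forall>i<k - ?n. \<mu>s ! (?n + i) = \<nu>s ! (?n + i))"
      using len assms(2) by (simp add: list_eq_iff_nth_eq)
    also have "\<dots> \<longleftrightarrow> (\<forall>i\<in>{?n..<k}. \<nu>s ! i = \<mu>s ! i)"
    proof (intro iffI ballI allI impI)
      fix i assume "\<forall>i<k - ?n. \<mu>s ! (?n + i) = \<nu>s ! (?n + i)" "i \<in> {?n..<k}"
      then show "\<nu>s ! i = \<mu>s ! i"
        by (auto dest: spec[of _ "i - ?n"])
    qed auto
    finally show ?thesis .
  qed
  have "tsem t (arrs \<mu>s \<sigma>) (arrs \<nu>s \<tau>) \<longleftrightarrow> arrs (drop ?n \<mu>s) \<sigma> = arrs (drop ?n \<nu>s) \<tau> \<and>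
     (\<forall>i<?n. rel_mset (tsem (children t ! i)) (\<nu>s ! (label t (Suc i) - 1)) (\<mu>s ! i))"
    unfolding split[of \<mu>s] split[of \<nu>s] using len assms(2) lt by (subst tsem_iff) auto
  also have "\<dots> \<longleftrightarrow> \<sigma> = \<tau> \<and> (\<forall>i\<in>{?n..<k}. \<nu>s ! i = \<mu>s ! i) \<and>
     (\<forall>i<?n. rel_mset (tsem (children t ! i)) (\<nu>s ! (label t (Suc i) - 1)) (\<mu>s ! i))"
    using len drop by auto
  also have "\<dots> \<longleftrightarrow> \<sigma> = \<tau> \<and>
    (\<forall>i<k. rel_mset (tsem (child t i)) (\<nu>s ! (label t (Suc i) - 1)) (\<mu>s ! i))"
  proof -
    have "rel_mset (tsem (child t i)) (\<nu>s ! (label t (Suc i) - 1)) (\<mu>s ! i) \<longleftrightarrow> \<nu>s ! i = \<mu>s ! i"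
      if "?n \<le> i" for i
      using that fix_ by (simp add: child_def multiset.rel_eq)
    moreover have "(\<forall>i<k. P i) \<longleftrightarrow> (\<forall>i\<in>{?n..<k}. P i) \<and> (\<forall>i<?n. P i)" for P
      using assms(2) by (auto simp: not_less intro: less_le_trans)
    ultimately show ?thesis
      by (simp add: child_def)
  qed
  finally show ?thesis .
qed

lemma tsem_sim: "tsem t \<sigma> \<tau> \<Longrightarrow> t \<in> PT \<Longrightarrow> u \<in> PT \<Longrightarrow> sim t u \<Longrightarrow> tsem u \<sigma> \<tau>"
proof (induction arbitrary: u rule: tsem.induct)
  case (1 \<mu>s ts \<nu>s \<pi> \<tau>)
  define k where "k = max (length ts) (length (children u))"
  note sim = simD[OF 1(6)]
  have \<pi>: "\<pi> permutes {1..length ts}" using PT_D(1)[OF 1(4)] by simp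
  \<comment> \<open>The target is split further, to provide enough arrows for the wider
    tree.\<close>
  obtain \<rho>s \<tau>' where \<tau>: "length \<rho>s = k - length ts" "\<tau> = arrs \<rho>s \<tau>'" by (rule arrs_cases)
  have "tsem u (arrs (\<mu>s @ \<rho>s) \<tau>') (arrs (\<nu>s @ \<rho>s) \<tau>')"
  proof (subst tsem_pad[OF 1(5)])
    show "\<tau>' = \<tau>' \<and>
        (\<forall>i<k. rel_mset (tsem (child u i)) ((\<nu>s @ \<rho>s) ! (label u (Suc i) - 1)) ((\<mu>s @ \<rho>s) ! i))"
    proof (intro conjI allI impI refl)
      fix i assume i: "i < k"
      show "rel_mset (tsem (child u i)) ((\<nu>s @ \<rho>s) ! (label u (Suc i) - 1)) ((\<mu>s @ \<rho>s) ! i)"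
      proof (cases "i < length ts")
        case True
        have "tsem (child u i) a b" if "tsem (ts ! i) a b"
          "ts ! i \<in> PT \<longrightarrow> (\<forall>u. u \<in> PT \<longrightarrow> sim (ts ! i) u \<longrightarrow> tsem u a b)" for a b
        proof (cases "i < length (children u)")
          case True
          then show ?thesis
            using that(2) \<open>i < length ts\<close> sim(2)[of i] PT_D(2)[OF 1(4), of i] PT_D(2)[OF 1(5), of i]
            by (simp add: child_def)
        next
          case False
          then show ?thesis
            using that(1) \<open>i < length ts\<close> sim(3)[of i] by (simp add: child_def tsem_fin_id)
        qed
        then have "rel_mset (tsem (child u i)) (\<nu>s ! (\<pi> (Suc i) - 1)) (\<mu>s ! i)"
          using 1(3) True by (auto elim!: multiset.rel_mono_strong)
        then show ?thesis
          using True 1(1,2) sim(1) permutes_pred(1)[OF \<pi> True] by (simp add: nth_append)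
      next
        case False
        then have "fin_id (child u i)" using sim(4)[of i] i by (simp add: k_def child_def)
        moreover have "label u (Suc i) = Suc i"
          using sim(1) False permutes_not_in[OF \<pi>, of "Suc i"] by simp
        ultimately show ?thesis
          using False 1(1,2) by (simp add: nth_append tsem_fin_id multiset.rel_eq)
      qed
    qed
  qed (use 1(1,2) \<tau> k_def in auto)
  then show ?case by (simp add: \<tau>)
qed

lemma tsem_eq_if_sim:
  assumes "t \<in> PT" "u \<in> PT" "sim t u"
  shows "tsem t = tsem u"
  using tsem_sim assms sim_sym by blast

section \<open>Separation\<close>

text \<open>The projection to argument \<open>i\<close> out of \<open>k\<close>, counted from
  0.\<close>

definition selector :: "nat \<Rightarrow> nat \<Rightarrow> tm" where
  "selector k i = (Lam ^^ k) (Var (k - 1 - i))"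

lemma typable_selector:
  assumes "i < k"
  shows "typable (selector k i) \<tau> \<Gamma> \<longleftrightarrow>
    \<Gamma> = {#} \<and> (\<exists>\<rho>. \<tau> = arrs ((replicate k {#})[i := {#\<rho>#}]) \<rho>)"
proof -
  have "map (\<lambda>j. at (k - 1 - j) {#(k - 1 - i, \<rho>)#}) [0..<k] = (replicate k {#})[i := {#\<rho>#}]" for \<rho>
    using assms by (intro nth_equalityI) (auto simp: nth_list_update)
  moreover have "down k {#(k - 1 - i, \<rho>)#} = {#}" for \<rho>
    using assms by simp
  ultimately show ?thesis
    unfolding selector_def typable_lams typable_Var by metis
qed

text \<open>The selector comes into head position, receives every child applied to the entry of
  \<open>Ns\<close> that the root label assigns to it, and keeps child \<open>i\<close>. All other
  argument multisets are empty, so discarded entries contribute nothing, even if untypable.\<close>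

lemma typable_child:
  assumes t: "t \<in> PT" "sem_HP t M" and k: "length (children t) \<le> k" "i < k" "length Ns = k"
  shows "typable (foldl App M (selector k i # Ns)) \<tau> \<Gamma> \<longleftrightarrow>
    (\<exists>\<sigma>. tsem (child t i) \<sigma> \<tau> \<and> typable (Ns ! (label t (Suc i) - 1)) \<sigma> \<Gamma>)" (is "?l \<longleftrightarrow> ?r")
proof -
  have \<pi>: "label t permutes {1..k}"
    using PT_D(1)[OF t(1)] k(1) by (auto intro: permutes_subset)
  define p where "p j = label t (Suc j) - 1" for j
  have p_lt: "p j < k" if "j < k" for j
    using permutes_pred(1)[OF \<pi> that] by (simp add: p_def)
  have p_inj: "p j = p j' \<longleftrightarrow> j = j'" if "j < k" "j' < k" for j j'
  proof
    assume "p j = p j'"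
    then have "label t (Suc j) = label t (Suc j')"
      using permutes_pred(2)[OF \<pi>] that unfolding p_def by metis
    then show "j = j'" using permutes_inj[OF \<pi>] by (auto dest: injD)
  qed simp
  have "p ` {..<k} = {..<k}"
    using p_lt p_inj by (intro endo_inj_surj) (auto simp: inj_on_def)
  then have p_surj: "\<exists>j<k. p j = q" if "q < k" for q
    using that by (metis image_iff lessThan_iff)
  show ?thesis
  proof
    assume ?l
    then obtain \<nu>s \<Delta> \<Gamma>s where *: "length \<nu>s = Suc k" "\<Gamma> = \<Delta> + (\<Sum>j<Suc k. \<Gamma>s j)"
      "typable M (arrs \<nu>s \<tau>) \<Delta>"
      "\<forall>j<Suc k. collect (typable ((selector k i # Ns) ! j)) (\<Gamma>s j) (\<nu>s ! j)"
      unfolding typable_foldl using k(3) by auto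
    then obtain \<mu> \<mu>s where \<nu>s: "\<nu>s = \<mu> # \<mu>s" "length \<mu>s = k" by (cases \<nu>s) auto
    from *(3) t(2) obtain \<sigma> where \<sigma>: "\<Delta> = {#}" "\<mu> = {#\<sigma>#}" "tsem t \<sigma> (arrs \<mu>s \<tau>)"
      by (auto simp: sem_HP_def \<nu>s)
    have "typable (selector k i) \<sigma> (\<Gamma>s 0)"
      using *(4)[rule_format, of 0] by (simp add: \<nu>s \<sigma>(2))
    then obtain \<rho> where \<rho>: "\<Gamma>s 0 = {#}" "\<sigma> = arrs ((replicate k {#})[i := {#\<rho>#}]) \<rho>"
      using typable_selector[OF k(2)] by blast
    have "length ((replicate k {#})[i := {#\<rho>#}]) = k" by simp
    note pad = tsem_pad[OF t(1) k(1) this \<nu>s(2)]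
    have sem: "\<rho> = \<tau>"
      "\<And>j. j < k \<Longrightarrow> rel_mset (tsem (child t j)) (\<mu>s ! p j) ((replicate k {#})[i := {#\<rho>#}] ! j)"
      using \<sigma>(3) unfolding \<rho>(2) pad p_def by blast+
    from sem(2)[OF k(2)] k(2) obtain \<sigma>' where \<sigma>': "\<mu>s ! p i = {#\<sigma>'#}" "tsem (child t i) \<sigma>' \<tau>"
      by (auto simp: sem(1) dest!: msed_rel_invR)
    have \<Gamma>s: "collect (typable (Ns ! j)) (\<Gamma>s (Suc j)) (\<mu>s ! j)" if "j < k" for j
      using *(4)[rule_format, of "Suc j"] that by (simp add: \<nu>s)
    have "\<Gamma>s (Suc q) = {#}" if q: "q < k" "q \<noteq> p i" for q
    proof -
      \<comment> \<open>Entry \<open>q\<close> goes to a child other than \<open>i\<close>, for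
        which the selector demands the empty multiset.\<close>
      obtain j where j: "j < k" "p j = q" using p_surj[OF q(1)] by blast
      then have "i \<noteq> j" using q(2) by auto
      then have "\<mu>s ! q = {#}" using sem(2)[OF j(1)] j by simp
      then show ?thesis using \<Gamma>s[OF q(1)] by simp
    qed
    then have "(\<Sum>j<k. \<Gamma>s (Suc j)) = (\<Sum>j<k. if j = p i then \<Gamma>s (Suc j) else {#})"
      by (intro sum.cong) auto
    then have "\<Gamma> = \<Gamma>s (Suc (p i))"
      unfolding *(2) sum.lessThan_Suc_shift using \<sigma>(1) \<rho>(1) p_lt[OF k(2)] by simp
    then show ?r
      using \<Gamma>s[OF p_lt[OF k(2)]] \<sigma>' by (auto simp: p_def)
  next
    assume ?r
    then obtain \<sigma> where \<sigma>: "tsem (child t i) \<sigma> \<tau>" "typable (Ns ! p i) \<sigma> \<Gamma>" by (auto simp: p_def)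
    define \<mu>s where "\<mu>s = (replicate k {#})[p i := {#\<sigma>#}]"
    \<comment> \<open>The type of the selector with result \<open>\<tau>\<close>; only argument
      \<open>i\<close> is used, once.\<close>
    define \<rho> where "\<rho> = arrs ((replicate k {#})[i := {#\<tau>#}]) \<tau>"
    have "rel_mset (tsem (child t j)) (\<mu>s ! p j) ((replicate k {#})[i := {#\<tau>#}] ! j)" if "j < k" for j
      using \<sigma>(1) p_lt p_inj[OF that k(2)] k(2) that
      by (cases "j = i") (simp_all add: \<mu>s_def rel_mset_Plus)
    then have "tsem t \<rho> (arrs \<mu>s \<tau>)"
      unfolding \<rho>_def p_def by (subst tsem_pad[OF t(1) k(1)]) (simp_all add: \<mu>s_def)
    then have "typable M (arrs ({#\<rho>#} # \<mu>s) \<tau>) {#}"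
      using t(2) by (auto simp: sem_HP_def)
    moreover have "collect (typable ((selector k i # Ns) ! j))
        (if j = Suc (p i) then \<Gamma> else {#}) (({#\<rho>#} # \<mu>s) ! j)" if "j < Suc k" for j
    proof (cases j)
      case 0
      then show ?thesis using typable_selector[OF k(2)] by (auto simp: \<rho>_def)
    next
      case (Suc q)
      then show ?thesis
        using that \<sigma>(2) p_lt[OF k(2)] by (auto simp: \<mu>s_def nth_list_update)
    qed
    moreover have "\<Gamma> = {#} + (\<Sum>j<Suc k. if j = Suc (p i) then \<Gamma> else {#})"
      using p_lt[OF k(2)] by simp
    moreover have "length ({#\<rho>#} # \<mu>s) = length (selector k i # Ns)"
      using k(3) by (simp add: \<mu>s_def)
    moreover have "length (selector k i # Ns) = Suc k"
      using k(3) by simp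
    ultimately show ?l
      unfolding typable_foldl
      by (intro exI[of _ "{#\<rho>#} # \<mu>s"] exI[of _ "{#}"] exI[of _ "\<lambda>j. if j = Suc (p i) then \<Gamma> else {#}"])
        (simp only:, blast)
  qed
qed

section \<open>Contexts that apply a term to arguments\<close>

primrec ctx_of :: "tm \<Rightarrow> ctx" where
  "ctx_of (Var i) = CVar i"
| "ctx_of (App M N) = CApp (ctx_of M) (ctx_of N)"
| "ctx_of (Lam M) = CLam (ctx_of M)"

lemma fill_ctx_of [simp]: "fill (ctx_of M) N = M"
  by (induction M) auto

definition app_ctx :: "tm list \<Rightarrow> ctx" where
  "app_ctx Ns = foldl CApp Hole (map ctx_of Ns)"

lemma fill_app_ctx [simp]: "fill (app_ctx Ns) M = foldl App M Ns"
  unfolding app_ctx_def by (induction Ns rule: rev_induct) auto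

primrec ctx_comp :: "ctx \<Rightarrow> ctx \<Rightarrow> ctx" where
  "ctx_comp Hole D = D"
| "ctx_comp (CVar i) D = CVar i"
| "ctx_comp (CApp C C') D = CApp (ctx_comp C D) (ctx_comp C' D)"
| "ctx_comp (CLam C) D = CLam (ctx_comp C D)"

lemma fill_ctx_comp: "fill (ctx_comp C D) M = fill C (fill D M)"
  by (induction C) auto

lemma Hplus_fill: "Hplus M N \<Longrightarrow> Hplus (fill C M) (fill C N)"
  unfolding Hplus_def by (metis fill_ctx_comp)

lemma Hplus_sym: "Hplus M N \<Longrightarrow> Hplus N M"
  by (simp add: Hplus_def)

lemma Hplus_nf: "Hplus M N \<Longrightarrow> has_beta_nf (fill C M) \<longleftrightarrow> has_beta_nf (fill C N)"
  by (simp add: Hplus_def)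

text \<open>The context \<open>\<lambda>y. [] U\<^sub>i y \<dots> y\<close> takes a term to its \<open>i\<close>-th child: only one of the
  arguments \<open>y\<close> is used.\<close>

definition child_ctx :: "nat \<Rightarrow> nat \<Rightarrow> ctx" where
  "child_ctx k i = CLam (app_ctx (selector k i # replicate k (Var 0)))"

text \<open>All arguments are the same variable, so it does not matter which of them the label
  assigns to child \<open>i\<close>.\<close>

lemma sem_HP_child:
  assumes "t \<in> PT" "sem_HP t M" "length (children t) \<le> k" "i < k"
  shows "sem_HP (child t i) (fill (child_ctx k i) M)"
proof -
  have "label t permutes {1..k}"
    using PT_D(1)[OF assms(1)] assms(3) by (auto intro: permutes_subset)
  then have "label t (Suc i) - 1 < k"
    using permutes_pred(1) assms(4) by blast
  then have *: "typable (foldl App M (selector k i # replicate k (Var 0))) \<tau> \<Gamma> \<longleftrightarrow>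
      (\<exists>\<sigma>. tsem (child t i) \<sigma> \<tau> \<and> \<Gamma> = {#(0, \<sigma>)#})" for \<tau> \<Gamma>
    using typable_child[OF assms, of "replicate k (Var 0)"] by simp
  have "typable (fill (child_ctx k i) M) \<tau> \<Gamma> \<longleftrightarrow> (\<exists>\<sigma> \<rho>. \<Gamma> = down 1 {#(0, \<sigma>)#} \<and>
      \<tau> = arr (at 0 {#(0, \<sigma>)#}) \<rho> \<and> tsem (child t i) \<sigma> \<rho>)" for \<tau> \<Gamma>
    unfolding child_ctx_def fill.simps fill_app_ctx typable_Lam * by blast
  then show ?thesis
    unfolding sem_HP_def by auto
qed

section \<open>Observing labels and finiteness\<close>

definition Omega :: tm where
  "Omega = App (Lam (App (Var 0) (Var 0))) (Lam (App (Var 0) (Var 0)))"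

lemma weak_head_Omega: "weak_head Omega Omega"
  using weak_head.intros(1)[of "App (Var 0) (Var 0)" "Lam (App (Var 0) (Var 0))"]
  by (simp add: Omega_def)

text \<open>A derivation would shrink strictly along the reduction of \<open>Omega\<close> to
  itself.\<close>

lemma not_typable_Omega [simp]: "\<not> typable Omega \<tau> \<Gamma>"
proof -
  have "\<not> ty Omega \<tau> (n, \<Gamma>)" for n
    by (induction n rule: less_induct) (use ty_weak_head[OF weak_head_Omega] in blast)
  then show ?thesis by (simp add: typable_def)
qed

text \<open>Where the labels differ, a harmless argument is placed so that only \<open>N\<close>
  passes it to the selected child, and \<open>Omega\<close> everywhere else.\<close>

lemma Hplus_label_eq:
  assumes t: "t \<in> PT" "sem_HP t M" and u: "u \<in> PT" "sem_HP u N" and H: "Hplus M N"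
  shows "label t = label u"
proof (rule ccontr)
  assume "label t \<noteq> label u"
  then obtain x where x: "label t x \<noteq> label u x" by blast
  define k where "k = max (length (children t)) (length (children u))"
  have perm: "label t permutes {1..k}" "label u permutes {1..k}"
    by (rule permutes_subset[OF PT_D(1)]; use t(1) u(1) in \<open>simp add: k_def\<close>)+
  have "x \<in> {1..k}"
    using x perm by (metis permutes_not_in)
  then obtain i where i: "x = Suc i" "i < k" by (cases x) auto
  let ?p = "label t (Suc i) - 1" and ?q = "label u (Suc i) - 1"
  have pq: "?p < k" "?q < k" "?p \<noteq> ?q"
    using permutes_pred[OF perm(1) i(2)] permutes_pred[OF perm(2) i(2)] x i(1) by auto
  define r where "r = length (children (child u i))"
  \<comment> \<open>The harmless argument discards the \<open>r\<close> arguments that the child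
    gives to its head, so even an infinite child gets a normal form. Under its \<open>r\<close>
    binders, \<open>Var r\<close> is the free variable \<open>0\<close>.\<close>
  define Ns where "Ns = (replicate k Omega)[?q := (Lam ^^ r) (Var r)]"
  have len: "length Ns = k" by (simp add: Ns_def)
  have "\<not> has_beta_nf (fill (app_ctx (selector k i # Ns)) M)"
    using typable_child[OF t _ i(2) len] pq
    by (simp add: has_beta_nf_iff Ns_def k_def del: foldl_Cons)
  moreover have "has_beta_nf (fill (app_ctx (selector k i # Ns)) N)"
  proof -
    \<comment> \<open>The type of a term that ignores \<open>r\<close> arguments: every condition on
      subtrees is met by empty multisets, which \<open>pos\<close> permits here.\<close>
    let ?\<tau> = "arrs (replicate r {#}) 0"
    have "tsem (child u i) ?\<tau> ?\<tau>"
      by (subst tsem_iff) (use permutes_pred(1)[OF PT_D(1)[OF child_PT[OF u(1)]]] in \<open>auto simp: r_def\<close>)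
    moreover have "typable (Ns ! ?q) ?\<tau> {#(0, 0)#}"
    proof -
      have "map (\<lambda>j. at (r - 1 - j) {#(r, 0)#}) [0..<r] = replicate r {#}"
        by (intro nth_equalityI) auto
      then show ?thesis
        using pq(2) unfolding Ns_def
        by (simp add: typable_lams) (intro exI[of _ "{#(r, 0)#}"] exI[of _ 0], simp)
    qed
    ultimately have "typable (foldl App N (selector k i # Ns)) ?\<tau> {#(0, 0)#}"
      using typable_child[OF u _ i(2) len] by (auto simp: k_def simp del: foldl_Cons)
    moreover have "pos ?\<tau>" unfolding pos_arrs by simp
    moreover have "negs {#(0, 0)#}" by simp
    ultimately show ?thesis
      unfolding has_beta_nf_iff fill_app_ctx by blast
  qed
  ultimately show False using Hplus_nf[OF H] by blast
qed

lemma rel_mset_memberR: "rel_mset R X Y \<Longrightarrow> b \<in># Y \<Longrightarrow> \<exists>a\<in>#X. R a b"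
  by (metis insert_DiffM msed_rel_invR union_single_eq_member)

text \<open>An infinite \<open>\<eta>\<close>-expansion has no finite derivation between types in which every
  argument must be typed.\<close>

lemma tsem_finite: "tsem t \<sigma> \<tau> \<Longrightarrow> t \<in> PT \<Longrightarrow> neg \<sigma> \<Longrightarrow> pos \<tau> \<Longrightarrow> finite {w. node t w}"
proof (induction rule: tsem.induct)
  case (1 \<mu>s ts \<nu>s \<pi> \<tau>)
  have \<pi>: "\<pi> permutes {1..length ts}" using PT_D(1)[OF 1(4)] by simp
  have "finite {w. node (ts ! i) w}" if i: "i < length ts" for i
  proof -
    have \<mu>: "\<mu>s ! i \<noteq> {#}" "\<forall>b\<in>#\<mu>s ! i. pos b"
      using 1(1,5) i by (auto simp: neg_arrs)
    then obtain b where b: "b \<in># \<mu>s ! i" by blast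
    obtain a where a: "a \<in># \<nu>s ! (\<pi> (Suc i) - 1)" "tsem (ts ! i) a b"
      "ts ! i \<in> PT \<longrightarrow> neg a \<longrightarrow> pos b \<longrightarrow> finite {w. node (ts ! i) w}"
      using rel_mset_memberR[OF 1(3)[rule_format, OF i] b] by blast
    have "\<nu>s ! (\<pi> (Suc i) - 1) \<in> set \<nu>s"
      using permutes_pred(1)[OF \<pi> i] 1(2) by simp
    then have "neg a" using 1(6) a(1) by (auto simp: pos_arrs)
    then show ?thesis using a(3) b \<mu>(2) PT_D(2)[OF 1(4), of i] i by simp
  qed
  then show ?case by (auto simp: finite_nodes_Node all_set_conv_all_nth)
qed

text \<open>A label sits at finite depth even in an infinite tree, so finitely many child
  extractions reach it; each turns a term with the typings of the identity into another such
  term.\<close>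

lemma Hplus_label_id:
  assumes "\<pi> \<in> labels t"
  shows "t \<in> PT \<Longrightarrow> sem_HP t M \<Longrightarrow> sem_HP (Node id []) N \<Longrightarrow> Hplus M N \<Longrightarrow> \<pi> = id"
  using assms
proof (induction arbitrary: M N rule: tree.set_induct[consumes 1, case_names label child])
  case (label \<pi> ts)
  then show ?case using Hplus_label_eq[OF label(1,2) fin_id_PT[OF fin_id_Leaf] label(3,4)] by simp
next
  case (child \<pi> ts t \<rho>)
  then obtain i where i: "i < length ts" "t = child (Node \<pi> ts) i"
    by (auto simp: in_set_conv_nth child_def)
  let ?C = "child_ctx (length ts) i"
  show ?case
  proof (rule child(3))
    show "t \<in> PT" using i child(4) child_PT by simp
    show "sem_HP t (fill ?C M)"
      using sem_HP_child[OF child(4,5)] i by simp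
    show "sem_HP (Node id []) (fill ?C N)"
      by (subst child_Leaf[of i, symmetric], rule sem_HP_child)
        (rule fin_id_PT fin_id_Leaf child(6) i(1) | simp)+
    show "Hplus (fill ?C M) (fill ?C N)" using child(7) by (rule Hplus_fill)
  qed
qed

text \<open>As the identity has a normal form, so has \<open>M\<close>; its \<open>pos\<close>
  typing relates a \<open>neg\<close> type to a \<open>pos\<close> one, which bounds the tree.
  Observing head normal forms would not exclude infinite eta-expansions here.\<close>

lemma Hplus_fin_id:
  assumes "t \<in> PT" "sem_HP t M" "sem_HP (Node id []) N" "Hplus M N"
  shows "fin_id t"
proof -
  have "typable N (arr {#0#} 0) {#}"
    using assms(3) unfolding sem_HP_def tsem_Leaf by blast
  then have "has_beta_nf N"
    unfolding has_beta_nf_iff by (intro exI[of _ "arr {#0#} 0"] exI[of _ "{#}"]) simp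
  then have "has_beta_nf M" using Hplus_nf[OF assms(4), of Hole] by simp
  then obtain \<tau> \<Gamma> where \<tau>: "typable M \<tau> \<Gamma>" "pos \<tau>"
    unfolding has_beta_nf_iff by blast
  then obtain \<sigma> \<rho> where "\<tau> = arr {#\<sigma>#} \<rho>" "tsem t \<sigma> \<rho>"
    using assms(2) unfolding sem_HP_def by blast
  then have "finite {w. node t w}" using tsem_finite assms(1) \<tau>(2) by simp
  then show ?thesis
    using assms Hplus_label_id by (intro E'_fin_id) (auto simp: E'_def)
qed

lemma Hplus_sim:
  assumes "t \<in> PT" "sem_HP t M" "u \<in> PT" "sem_HP u N" "Hplus M N"
  shows "sim t u"
proof -
  \<comment> \<open>The terms are quantified inside the coinduction invariant because each
    extraction replaces them.\<close>
  have "\<exists>M N. t \<in> PT \<and> sem_HP t M \<and> u \<in> PT \<and> sem_HP u N \<and> Hplus M N"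
    using assms by blast
  then show ?thesis
  proof (coinduction arbitrary: t u)
    case (sim t u)
    then obtain M N where *: "t \<in> PT" "sem_HP t M" "u \<in> PT" "sem_HP u N" "Hplus M N" by blast
    define k where "k = max (length (children t)) (length (children u))"
    have child: "child t i \<in> PT" "sem_HP (child t i) (fill (child_ctx k i) M)"
      "child u i \<in> PT" "sem_HP (child u i) (fill (child_ctx k i) N)"
      "Hplus (fill (child_ctx k i) M) (fill (child_ctx k i) N)"
      "Hplus (fill (child_ctx k i) N) (fill (child_ctx k i) M)" if "i < k" for i
      using * that by (auto simp: k_def sem_HP_child child_PT Hplus_fill Hplus_sym)
    have "\<exists>M N. children t ! i \<in> PT \<and> sem_HP (children t ! i) M \<and> children u ! i \<in> PT \<and>
        sem_HP (children u ! i) N \<and> Hplus M N"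
      if "i < length (children t)" "i < length (children u)" for i
    proof -
      have "i < k" "child t i = children t ! i" "child u i = children u ! i"
        using that by (simp_all add: child_def k_def)
      then show ?thesis using child[of i] by metis
    qed
    moreover have "fin_id (children t ! i)" if "i < length (children t)" "length (children u) \<le> i" for i
    proof -
      have "i < k" "child t i = children t ! i" "child u i = Node id []"
        using that by (simp_all add: child_def k_def)
      then show ?thesis using child[of i] Hplus_fin_id by metis
    qed
    moreover have "fin_id (children u ! i)" if "i < length (children u)" "length (children t) \<le> i" for i
    proof -
      have "i < k" "child t i = Node id []" "child u i = children u ! i"
        using that by (simp_all add: child_def k_def)
      then show ?thesis using child[of i] Hplus_fin_id by metis
    qed
    ultimately show ?case
      using Hplus_label_eq[OF *] by auto
  qed
qed

theorem Hplus_iff_sim: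
  assumes "t \<in> PT" "sem_HP t M" "u \<in> PT" "sem_HP u N"
  shows "Hplus M N \<longleftrightarrow> sim t u"
  using Hplus_sim Hplus_if_sem_HP tsem_eq_if_sim assms by metis

section \<open>Similarity, common expansions and minimal trees\<close>

text \<open>Sums up the stripping of one last child at a time; \<open>m\<close> children are kept.
  Labels count from 1 and lists from 0, so the last kept child is \<open>m - 1\<close> but the label
  is tested at \<open>m\<close>.\<close>

lemma minimize_strip:
  "\<exists>m\<le>length (children t). minimize t = Node (label t) (map minimize (take m (children t))) \<and>
    (\<forall>i. m \<le> i \<longrightarrow> i < length (children t) \<longrightarrow> fin_id (children t ! i) \<and> label t (Suc i) = Suc i) \<and>
    (m = 0 \<or> \<not> (fin_id (children t ! (m - 1)) \<and> label t m = m))"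
proof (induction "length (children t)" arbitrary: t rule: less_induct)
  case less
  obtain \<pi> ts where t: "t = Node \<pi> ts" by (cases t)
  let ?n = "length ts"
  show ?case
  proof (cases "ts \<noteq> [] \<and> last ts \<in> E' \<and> \<pi> ?n = ?n")
    case True
    then have min: "minimize t = minimize (Node \<pi> (butlast ts))"
      by (subst minimize.code) (simp add: t Let_def)
    from less[of "Node \<pi> (butlast ts)"] True obtain m where m: "m \<le> ?n - 1"
      "minimize t = Node \<pi> (map minimize (take m (butlast ts)))"
      "\<And>i. m \<le> i \<Longrightarrow> i < ?n - 1 \<Longrightarrow> fin_id (butlast ts ! i) \<and> \<pi> (Suc i) = Suc i"
      "m = 0 \<or> \<not> (fin_id (butlast ts ! (m - 1)) \<and> \<pi> m = m)"
      unfolding min by (auto simp: t)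
    have "fin_id (ts ! i) \<and> \<pi> (Suc i) = Suc i" if "m \<le> i" "i < ?n" for i
    proof (cases "i = ?n - 1")
      case True
      then show ?thesis
        using \<open>ts \<noteq> [] \<and> _\<close> that by (auto simp: last_conv_nth E'_eq)
    next
      case False
      then show ?thesis using m(3)[of i] that by (simp add: nth_butlast)
    qed
    moreover have "m = 0 \<or> \<not> (fin_id (ts ! (m - 1)) \<and> \<pi> m = m)"
      using m(1,4) by (cases m) (auto simp: nth_butlast)
    moreover have "take m (butlast ts) = take m ts"
      using m(1) by (simp add: butlast_conv_take min_def)
    ultimately show ?thesis
      using m(1,2) by (intro exI[of _ m]) (auto simp: t)
  next
    case False
    then have "minimize t = Node \<pi> (map minimize ts)"
      by (subst minimize.code) (auto simp: t Let_def)
    moreover have "ts = [] \<or> \<not> (fin_id (ts ! (?n - 1)) \<and> \<pi> ?n = ?n)"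
      using False by (auto simp: last_conv_nth E'_eq)
    ultimately show ?thesis
      by (intro exI[of _ ?n]) (auto simp: t)
  qed
qed

lemma minimize_fin_id:
  assumes "fin_id t"
  shows "minimize t = Node id []"
proof -
  have t: "label t = id" "\<And>i. i < length (children t) \<Longrightarrow> fin_id (children t ! i)"
    using assms fin_id_iff[of t] by simp_all
  obtain m where m: "m \<le> length (children t)"
    "minimize t = Node (label t) (map minimize (take m (children t)))"
    "m = 0 \<or> \<not> (fin_id (children t ! (m - 1)) \<and> label t m = m)"
    using minimize_strip[of t] by blast
  then have "m = 0" using t by (cases m) auto
  then show ?thesis using m(2) t(1) by simp
qed

lemma sim_if_minimize_eq: "minimize t = minimize u \<Longrightarrow> sim t u"
proof (coinduction arbitrary: t u)
  case (sim t u)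
  obtain m where m: "m \<le> length (children t)"
    "minimize t = Node (label t) (map minimize (take m (children t)))"
    "\<And>i. m \<le> i \<Longrightarrow> i < length (children t) \<Longrightarrow> fin_id (children t ! i)"
    using minimize_strip[of t] by blast
  obtain m' where m': "m' \<le> length (children u)"
    "minimize u = Node (label u) (map minimize (take m' (children u)))"
    "\<And>i. m' \<le> i \<Longrightarrow> i < length (children u) \<Longrightarrow> fin_id (children u ! i)"
    using minimize_strip[of u] by blast
  have eq: "label t = label u" "map minimize (take m (children t)) = map minimize (take m' (children u))"
    using sim m(2) m'(2) by auto
  have mm: "m = m'"
    using arg_cong[OF eq(2), of length] m(1) m'(1) by simp
  have "minimize (children t ! i) = minimize (children u ! i)"
    if "i < length (children t)" "i < length (children u)" for i
  proof (cases "i < m")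
    case True
    then show ?thesis
      using arg_cong[OF eq(2), of "\<lambda>ts. ts ! i"] that mm by simp
  next
    \<comment> \<open>Both children were stripped, so both are finite identities and minimize to the
      leaf.\<close>
    case False
    then show ?thesis
      using m(3) m'(3) that mm by (simp add: minimize_fin_id)
  qed
  then show ?case
    using eq(1) m(1,3) m'(1,3) mm by auto
qed

text \<open>What makes a last child removable is transferred by \<open>sim\<close>, so a position
  kept in \<open>t\<close> cannot be stripped in \<open>u\<close>. Used in both directions, this
  equates the numbers of kept children.\<close>

lemma minimize_length_le:
  assumes "u \<in> PT" "sim t u"
    and m: "m \<le> length (children t)" "m = 0 \<or> \<not> (fin_id (children t ! (m - 1)) \<and> label t m = m)"
    and m': "\<forall>i. m' \<le> i \<longrightarrow> i < length (children u) \<longrightarrow> fin_id (children u ! i) \<and> label u (Suc i) = Suc i"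
  shows "m \<le> m'"
proof (rule ccontr)
  assume "\<not> m \<le> m'"
  then obtain i where i: "m = Suc i" "m' \<le> i" by (cases m) auto
  have fix_: "label t (Suc i) = Suc i" "fin_id (children t ! i)"
  proof -
    \<comment> \<open>Either \<open>u\<close> strips this position, or its children end before it
      and its label fixes the position anyway.\<close>
    show "label t (Suc i) = Suc i"
      using simD(1)[OF assms(2)] m'[rule_format, OF i(2)]
        permutes_not_in[OF PT_D(1)[OF assms(1)], of "Suc i"]
      by (cases "i < length (children u)") auto
    show "fin_id (children t ! i)"
      using simD(2,3)[OF assms(2), of i] m'[rule_format, OF i(2)] m(1) i(1) sim_fin_id
      by (cases "i < length (children u)") auto
  qed
  then show False using m(2) i(1) by simp
qed

lemma minimize_eq_if_sim: "t \<in> PT \<Longrightarrow> u \<in> PT \<Longrightarrow> sim t u \<Longrightarrow> minimize t = minimize u"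
proof (coinduction arbitrary: t u rule: tree.coinduct)
  case (Eq_tree t u)
  obtain m where m: "m \<le> length (children t)"
    "minimize t = Node (label t) (map minimize (take m (children t)))"
    "\<forall>i. m \<le> i \<longrightarrow> i < length (children t) \<longrightarrow> fin_id (children t ! i) \<and> label t (Suc i) = Suc i"
    "m = 0 \<or> \<not> (fin_id (children t ! (m - 1)) \<and> label t m = m)"
    using minimize_strip[of t] by blast
  obtain m' where m': "m' \<le> length (children u)"
    "minimize u = Node (label u) (map minimize (take m' (children u)))"
    "\<forall>i. m' \<le> i \<longrightarrow> i < length (children u) \<longrightarrow> fin_id (children u ! i) \<and> label u (Suc i) = Suc i"
    "m' = 0 \<or> \<not> (fin_id (children u ! (m' - 1)) \<and> label u m' = m')"
    using minimize_strip[of u] by blast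
  have "m = m'"
    using minimize_length_le[OF Eq_tree(2,3) m(1,4) m'(3)]
      minimize_length_le[OF Eq_tree(1) sim_sym[OF Eq_tree(3)] m'(1,4) m(3)] by simp
  then have "list_all2 (\<lambda>a b. \<exists>t u. a = minimize t \<and> b = minimize u \<and> t \<in> PT \<and> u \<in> PT \<and> sim t u)
      (children (minimize t)) (children (minimize u))"
    using m(1,2) m'(1,2) simD(2)[OF Eq_tree(3)] PT_D(2)[OF Eq_tree(1)] PT_D(2)[OF Eq_tree(2)]
    by (auto simp: list_all2_conv_all_nth intro!: exI conjI[OF refl conjI[OF refl]])
  then show ?case
    using m(2) m'(2) simD(1)[OF Eq_tree(3)] by simp
qed

section \<open>Common expansions\<close>

lemma le_PTD:
  assumes "le_PT t u"
  shows "t \<in> PT" "u \<in> PT" "label t = label u" "length (children u) \<le> length (children t)"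
    "i < length (children u) \<Longrightarrow> le_PT (children t ! i) (children u ! i)"
    "i < length (children t) \<Longrightarrow> length (children u) \<le> i \<Longrightarrow> fin_id (children t ! i)"
  using assms by (auto elim: le_PT.cases simp: E'_eq)

lemma le_PT_fin_id: "fin_id t \<Longrightarrow> le_PT t u \<Longrightarrow> fin_id u"
proof (induction arbitrary: u rule: fin_id.induct)
  case (1 ts)
  have "fin_id (children u ! i)" if "i < length (children u)" for i
  proof -
    have "ts ! i \<in> set ts" using le_PTD(4)[OF 1(2)] that by simp
    moreover have "le_PT (ts ! i) (children u ! i)" using le_PTD(5)[OF 1(2) that] by simp
    ultimately show ?thesis using 1(1) by blast
  qed
  then show ?case
    using le_PTD(3)[OF 1(2)] by (subst fin_id_iff) simp
qed

text \<open>Where \<open>t\<close> is wider than \<open>u\<close>, the common expansion has a finite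
  identity, and a tree that expands to a finite identity is one itself.\<close>

lemma sim_if_sigma: "sigma_PT t u \<Longrightarrow> sim t u"
  unfolding sigma_PT_def
proof (coinduction arbitrary: t u)
  case sim
  then obtain w where w: "le_PT w t" "le_PT w u" by blast
  note t = le_PTD[OF w(1)] and u = le_PTD[OF w(2)]
  have "\<exists>w\<in>PT. le_PT w (children t ! i) \<and> le_PT w (children u ! i)"
    if "i < length (children t)" "i < length (children u)" for i
    using t(5) u(5) that le_PTD(1) by blast
  moreover have "fin_id (children t ! i)" if "i < length (children t)" "length (children u) \<le> i" for i
    using t(4) t(5)[of i] u(6)[of i] that le_PT_fin_id by simp
  moreover have "fin_id (children u ! i)" if "i < length (children u)" "length (children t) \<le> i" for i
    using u(4) u(5)[of i] t(6)[of i] that le_PT_fin_id by simp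
  ultimately show ?case using t(3) u(3) by auto
qed

text \<open>The common expansion of two similar trees, on the union of their nodes. Similar trees
  have equal root labels, so taking the label from \<open>t\<close> favours neither.\<close>

primcorec merge :: "ptree \<Rightarrow> ptree \<Rightarrow> ptree" where
  "merge t u = Node (label t) (map (\<lambda>i.
     if i < length (children t) \<and> i < length (children u) then merge (children t ! i) (children u ! i)
     else if i < length (children t) then children t ! i else children u ! i)
     [0..<max (length (children t)) (length (children u))])"

declare merge.simps(2) [simp del]

lemma length_children_merge [simp]:
  "length (children (merge t u)) = max (length (children t)) (length (children u))"
  by (simp add: merge.simps(2))

lemma nth_children_merge:
  "i < length (children t) \<Longrightarrow> i < length (children u) \<Longrightarrow>
    children (merge t u) ! i = merge (children t ! i) (children u ! i)"
  "i < length (children t) \<Longrightarrow> length (children u) \<le> i \<Longrightarrow> children (merge t u) ! i = children t ! i"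
  "i < length (children u) \<Longrightarrow> length (children t) \<le> i \<Longrightarrow> children (merge t u) ! i = children u ! i"
  by (simp_all add: merge.simps(2) less_max_iff_disj)

lemma merge_sim_PT: "t \<in> PT \<Longrightarrow> u \<in> PT \<Longrightarrow> sim t u \<Longrightarrow> merge t u \<in> PT"
proof (coinduction arbitrary: t u rule: PT.coinduct)
  case (PT t u)
  have "{1..length (children t)} \<subseteq> {1..length (children (merge t u))}"
    unfolding length_children_merge by auto
  then have "label t permutes {1..length (children (merge t u))}"
    by (rule permutes_subset[OF PT_D(1)[OF PT(1)]])
  moreover have "(\<exists>t u. s = merge t u \<and> t \<in> PT \<and> u \<in> PT \<and> sim t u) \<or> s \<in> PT"
    if s: "s \<in> set (children (merge t u))" for s
  proof -
    obtain i where i: "i < length (children (merge t u))" "children (merge t u) ! i = s"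
      using s by (meson in_set_conv_nth)
    consider "i < length (children t)" "i < length (children u)"
      | "i < length (children t)" "length (children u) \<le> i"
      | "i < length (children u)" "length (children t) \<le> i"
      using i(1) by fastforce
    then show ?thesis
    proof cases
      case 1
      then show ?thesis
        using i(2) nth_children_merge(1)[OF 1] PT_D(2)[OF PT(1)] PT_D(2)[OF PT(2)]
          simD(2)[OF PT(3)] by metis
    next
      case 2
      then show ?thesis using i(2) nth_children_merge(2)[OF 2] PT_D(2)[OF PT(1)] by metis
    next
      case 3
      then show ?thesis using i(2) nth_children_merge(3)[OF 3] PT_D(2)[OF PT(2)] by metis
    qed
  qed
  moreover have "merge t u = Node (label t) (children (merge t u))"
    by (metis merge.simps(1) tree.collapse)
  ultimately show ?case by blast
qed

lemma le_PT_refl: "t \<in> PT \<Longrightarrow> le_PT t t"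
proof (coinduction arbitrary: t)
  case (le_PT t)
  then show ?case
    by (cases t) (use le_PT PT_D(2)[OF le_PT] in auto)
qed

text \<open>One coinduction serves both trees, with \<open>v\<close> as either of them. A child
  present on one side only is copied, and there reflexivity takes over.\<close>

lemma le_merge:
  "t \<in> PT \<Longrightarrow> u \<in> PT \<Longrightarrow> sim t u \<Longrightarrow> v = t \<or> v = u \<Longrightarrow> le_PT (merge t u) v"
proof (coinduction arbitrary: t u v)
  case (le_PT t u v)
  note sim = simD[OF le_PT(3)]
  let ?ws = "children (merge t u)"
  have "merge t u = Node (label t) ?ws" by (metis merge.simps(1) tree.collapse)
  moreover have "v = Node (label v) (children v)" by simp
  moreover have "merge t u \<in> PT" using merge_sim_PT le_PT(1-3) .
  moreover have "v \<in> PT" "label t = label v" "length (children v) \<le> length ?ws"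
    using le_PT sim(1) by auto
  moreover have "(\<exists>t u v'. ?ws ! i = merge t u \<and> children v ! i = v' \<and> t \<in> PT \<and> u \<in> PT \<and> sim t u \<and>
      (v' = t \<or> v' = u)) \<or> le_PT (?ws ! i) (children v ! i)" if i: "i < length (children v)" for i
  proof (cases "i < length (children t) \<and> i < length (children u)")
    case True
    then have "?ws ! i = merge (children t ! i) (children u ! i)" by (simp add: nth_children_merge)
    then show ?thesis
      using True le_PT(4) sim(2) PT_D(2)[OF le_PT(1)] PT_D(2)[OF le_PT(2)] by blast
  next
    case False
    then have "?ws ! i = children v ! i" using i le_PT(4) by (auto simp: nth_children_merge not_less)
    then show ?thesis using PT_D(2)[OF \<open>v \<in> PT\<close> i] le_PT_refl by simp
  qed
  moreover have "?ws ! i \<in> E'" if "i \<in> {length (children v)..<length ?ws}" for i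
    using that le_PT(4) sim(3,4) by (auto simp: E'_eq nth_children_merge less_max_iff_disj)
  ultimately show ?case
    by (intro exI[of _ "label t"] exI[of _ ?ws] exI[of _ "label v"] exI[of _ "children v"] conjI)
      (simp_all only: tree.collapse simp_thms, simp_all)
qed

lemma sigma_iff_sim:
  assumes "t \<in> PT" "u \<in> PT"
  shows "sigma_PT t u \<longleftrightarrow> sim t u"
  using assms sim_if_sigma merge_sim_PT le_merge unfolding sigma_PT_def by blast

lemma minimize_eq_iff_sim:
  assumes "t \<in> PT" "u \<in> PT"
  shows "minimize t = minimize u \<longleftrightarrow> sim t u"
  using assms minimize_eq_if_sim sim_if_minimize_eq by blast

section \<open>The characterization theorem\<close>

theorem theorem4p15:
  fixes M N :: tm
  assumes "M \<in> HP" and "N \<in> HP"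
  shows "(Hplus M N \<longleftrightarrow> sigma_PT (tree_of M) (tree_of N)) \<and>
    (sigma_PT (tree_of M) (tree_of N) \<longleftrightarrow> minimize (tree_of M) = minimize (tree_of N))"
proof -
  have PT: "tree_of M \<in> PT" "tree_of N \<in> PT"
    using tree_of_props(1) assms by auto
  have "sem_HP (tree_of M) M" "sem_HP (tree_of N) N"
    using sem_HP_if_BT tree_of_props assms by auto
  then have "Hplus M N \<longleftrightarrow> sim (tree_of M) (tree_of N)"
    using Hplus_iff_sim PT by blast
  then show ?thesis
    using sigma_iff_sim[OF PT] minimize_eq_iff_sim[OF PT] by blast
qed

end
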